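(* Assume $\sigma^2, \tilde b \in C^1([0,1])$ with $\min_{[0,1]} \sigma^2 > 0$. Let $\tilde f \in C^1([0,1])$ be bistable: $\tilde f(0) = \tilde f(1) = 0$, and $\tilde f$ has exactly one interior zero $q^* \in (0,1)$, with $\tilde f < 0$ on $(0, q^* )$ and $\tilde f > 0$ on $(q^*, 1)$. Assume also that the three zeros are nondegenerate: $\tilde f'(0) < 0$, $\tilde f'(q^* ) > 0$, and $\tilde f'(1) < 0$. Then: (i) There exist a speed $c \in \mathbb{R}$ and a strictly increasing profile $V \in C^2(\mathbb{R})$ with $V(-\infty) = 0$ and $V(+\infty) = 1$, solving the traveling-wave equation $$\frac{d}{d\xi}\Big(\frac{\sigma^2(V)}{2}\,V'\Big) + \big(c - \tilde b(V)\big)\,V' + \tilde f(V) = 0,\qquad \xi\in\mathbb{R}.$$ The pair is unique, in that no other speed admits a wavefront joining $0$ and $1$, and the profile is unique up to translation. (ii) $V$ approaches each of its limits exponentially fast. The rate at the end state $e$ is a root of the characteristic equation $$\tfrac{1}{2}\,\sigma^2(e)\, r^2 + \big(c - \tilde b(e)\big)\, r + \tilde f'(e) = 0, \qquad e \in \{0, 1\},$$ namely the positive root at $e = 0$ and the negative root at $e = 1$. That is, $\xi^{-1}\log |V(\xi)-e| \to r$ as $\xi\to-\infty$ for $e=0$ with $r$ the positive root, and as $\xi\to+\infty$ for $e=1$ with $r$ the negative root. (iii) The level parameterization of $V$ satisfies the wave identity $$\varphi'(s) = \tilde b(s) - c - \frac{\tilde f(s)}{g(s)},\qquad s\in(0,1),$$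 with boundary values $\varphi(0) = \varphi(1) = 0$, where $g(s)$ is the value of $V'$ at level $s$ and $\varphi(s)=\tfrac12\sigma^2(s)g(s)$.
   Context: Here $\sigma^2:[0,1]\to(0,\infty)$. A wavefront joining $0$ and $1$ with speed $c$ is a strictly increasing $C^2$ profile $V$ on $\mathbb{R}$ with limits $0$ at $-\infty$ and $1$ at $+\infty$ solving the traveling-wave equation with that $c$. For such a profile, the level parameterization is $g(s)=V'(V^{-1}(s))$ for $s\in(0,1)$, with flux $\varphi(s)=\tfrac12\sigma^2(s)g(s)$; the boundary values $\varphi(0),\varphi(1)$ are understood as limits as $s\to0$ and $s\to1$. *)

theory Defs
  imports "HOL-Analysis.Analysis"
begin

text \<open>
  One-sided derivatives at the end points are meant when \<open>S\<close> is a closed interval; the library's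
  \<open>C1_differentiable_on\<close> demands two-sided derivatives, which is too strong for \<open>C\<^sup>1([0,1])\<close>.
\<close>

definition C1_with_deriv :: "(real \<Rightarrow> real) \<Rightarrow> (real \<Rightarrow> real) \<Rightarrow> real set \<Rightarrow> bool" where
  "C1_with_deriv f f' S \<longleftrightarrow>
     (\<forall>x\<in>S. (f has_real_derivative f' x) (at x within S)) \<and> continuous_on S f'"

definition C1_on :: "(real \<Rightarrow> real) \<Rightarrow> real set \<Rightarrow> bool" where
  "C1_on f S \<longleftrightarrow> (\<exists>f'. C1_with_deriv f f' S)"

definition C2_real :: "(real \<Rightarrow> real) \<Rightarrow> bool" where
  "C2_real V \<longleftrightarrow>
     (\<forall>x. V differentiable (at x)) \<and> (\<forall>x. deriv V differentiable (at x)) \<and>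
     continuous_on UNIV (deriv (deriv V))"

definition bistable :: "(real \<Rightarrow> real) \<Rightarrow> real \<Rightarrow> bool" where
  "bistable f q \<longleftrightarrow>
     f 0 = 0 \<and> f 1 = 0 \<and> q \<in> {0<..<1} \<and> {s\<in>{0<..<1}. f s = 0} = {q} \<and>
     (\<forall>s\<in>{0<..<q}. f s < 0) \<and> (\<forall>s\<in>{q<..<1}. f s > 0)"

text \<open>
  The argument \<open>\<sigma>2\<close> stands for the function \<open>\<sigma>\<^sup>2\<close> itself and is never squared.
  Differentiability of the flux is stated explicitly, as \<open>deriv\<close> is an arbitrary value otherwise.
\<close>

definition traveling_wave_eq ::
  "(real \<Rightarrow> real) \<Rightarrow> (real \<Rightarrow> real) \<Rightarrow> (real \<Rightarrow> real) \<Rightarrow> real \<Rightarrow> (real \<Rightarrow> real) \<Rightarrow> bool" where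
  "traveling_wave_eq \<sigma>2 b f c V \<longleftrightarrow>
     (\<forall>\<xi>. (\<lambda>x. \<sigma>2 (V x) / 2 * deriv V x) differentiable (at \<xi>) \<and>
          deriv (\<lambda>x. \<sigma>2 (V x) / 2 * deriv V x) \<xi> + (c - b (V \<xi>)) * deriv V \<xi> + f (V \<xi>) = 0)"

definition wavefront ::
  "(real \<Rightarrow> real) \<Rightarrow> (real \<Rightarrow> real) \<Rightarrow> (real \<Rightarrow> real) \<Rightarrow> real \<Rightarrow> (real \<Rightarrow> real) \<Rightarrow> bool" where
  "wavefront \<sigma>2 b f c V \<longleftrightarrow>
     strict_mono V \<and> C2_real V \<and> (V \<longlongrightarrow> 0) at_bot \<and> (V \<longlongrightarrow> 1) at_top \<and>
     traveling_wave_eq \<sigma>2 b f c V"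

text \<open>
  The range of a wavefront profile is \<open>(0,1)\<close>, so \<open>inv V s\<close> is the true inverse there;
  the values of the next two functions outside \<open>(0,1)\<close> are irrelevant.
\<close>

definition level_param :: "(real \<Rightarrow> real) \<Rightarrow> real \<Rightarrow> real" where
  "level_param V s = deriv V (inv V s)"

definition flux :: "(real \<Rightarrow> real) \<Rightarrow> (real \<Rightarrow> real) \<Rightarrow> real \<Rightarrow> real" where
  "flux \<sigma>2 V s = 1 / 2 * \<sigma>2 s * level_param V s"

definition char_poly_at ::
  "(real \<Rightarrow> real) \<Rightarrow> (real \<Rightarrow> real) \<Rightarrow> (real \<Rightarrow> real) \<Rightarrow> real \<Rightarrow> real \<Rightarrow> real \<Rightarrow> real" where
  "char_poly_at \<sigma>2 b f' c e r = 1 / 2 * \<sigma>2 e * r\<^sup>2 + (c - b e) * r + f' e"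

end

theory Submission
  imports Defs
begin

text \<open>
  In terms of the flux \<open>\<phi>(s) = \<sigma>\<^sup>2 V' / 2\<close> at level \<open>s\<close>, and with \<open>F = \<sigma>\<^sup>2 f / 2\<close>, a front
  is a positive solution of \<open>\<phi>' = b - c - F / \<phi>\<close> on \<open>(0,1)\<close> vanishing at both end points.
  On \<open>(0,q)\<close>, and after the reflection \<open>s \<mapsto> 1 - s\<close> also on \<open>(q,1)\<close>, it has the form
  \<open>\<phi>' = A + h / \<phi>\<close> with \<open>h > 0\<close>. The right-hand side decreases in \<open>\<phi>\<close>, so for every \<open>c\<close>
  there is exactly one orbit leaving the rest state, and it depends monotonically on \<open>c\<close>. The
  values at \<open>q\<close> of the orbits leaving \<open>0\<close> and \<open>1\<close> move in opposite directions as \<open>c\<close> varies,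
  so they agree for some speed; the common value is positive because \<open>f'(q) > 0\<close>. Strict
  monotonicity makes this speed unique.
  The profile is recovered from \<open>V' = 2 \<phi>(V) / \<sigma>\<^sup>2(V)\<close>. Comparison with straight lines shows
  that \<open>\<phi>\<close> has the slopes at \<open>0\<close> and \<open>1\<close> predicted by the characteristic equation, which
  gives both the exponential rates and that \<open>V\<close> reaches its limits only at infinity.
\<close>

section \<open>The initial value problem\<close>

text \<open>Take the last point \<open>t\<close> of \<open>{a..s}\<close> with
  \<open>0 \<le> D t\<close>. If \<open>D s\<close> were negative, \<open>D\<close> would be
  negative and hence nondecreasing on \<open>(t,s)\<close>, so \<open>D s \<ge> D t\<close>. A sign
  of the derivative is asked only where \<open>D < 0\<close> and never at \<open>a\<close>; this
  suits comparison arguments for equations that are singular at the initial point.\<close>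

lemma nonneg_of_barrier:
  fixes D :: "real \<Rightarrow> real"
  assumes cont: "continuous_on {a..b} D" and init: "0 \<le> D a"
    and deriv: "\<And>s. a < s \<Longrightarrow> s < b \<Longrightarrow> D s < 0 \<Longrightarrow> \<exists>d\<ge>0. (D has_real_derivative d) (at s)"
    and s: "s \<in> {a..b}"
  shows "0 \<le> D s"
proof (rule ccontr)
  assume neg: "\<not> 0 \<le> D s"
  define S where "S = {r \<in> {a..s}. 0 \<le> D r}"
  have cs: "continuous_on {a..s} D" using cont s by (auto intro: continuous_on_subset)
  have "S = {a..s} \<inter> D -` {0..}" by (auto simp: S_def)
  then have "closed S" using continuous_closed_preimage[OF cs, of "{0..}"] by simp
  moreover have "bounded S"
    by (rule bounded_subset[OF bounded_closed_interval[of a s]]) (auto simp: S_def)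
  ultimately have "compact S" by (simp add: compact_eq_bounded_closed)
  moreover have "a \<in> S" using init s by (auto simp: S_def)
  ultimately obtain t where t: "t \<in> S" "\<And>r. r \<in> S \<Longrightarrow> r \<le> t"
    using compact_attains_sup[of S] by blast
  have ts: "a \<le> t" "t \<le> s" "0 \<le> D t" using t(1) by (auto simp: S_def)
  have "D t \<le> D s"
  proof (rule DERIV_nonneg_imp_increasing_open[of t s D])
    show "t \<le> s" by fact
    show "continuous_on {t..s} D" using cs ts by (auto intro: continuous_on_subset)
    fix x assume x: "t < x" "x < s"
    then have "D x < 0" using t(2)[of x] ts by (force simp: S_def)
    then show "\<exists>y. (D has_real_derivative y) (at x) \<and> 0 \<le> y"
      using deriv[of x] x ts s by auto
  qed
  then show False using neg ts by simp
qed

text \<open>Banach's fixed point theorem in an exponentially weighted sup norm. The weight makes the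
  integral operator a contraction on the whole interval at once, so no continuation of local
  solutions is involved.\<close>

lemma picard_lindelof_interval:
  fixes G :: "real \<Rightarrow> real \<Rightarrow> real"
  assumes L: "0 \<le> L" and \<Lambda>: "0 < \<Lambda>"
    and cont: "\<And>y. continuous_on {0..L} y \<Longrightarrow> continuous_on {0..L} (\<lambda>s. G s (y s))"
    and lip: "\<And>s y z. s \<in> {0..L} \<Longrightarrow> \<bar>G s y - G s z\<bar> \<le> \<Lambda> * \<bar>y - z\<bar>"
  obtains y where "y 0 = y0"
    and "\<And>s. s \<in> {0..L} \<Longrightarrow> (y has_real_derivative G s (y s)) (at s within {0..L})"
proof -
  \<comment> \<open>The contraction factor comes out as
    \<open>\<Lambda> / \<mu> = 1/2\<close>.\<close>
  define \<mu> where "\<mu> = 2 * \<Lambda>"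
  have \<mu>: "0 < \<mu>" using \<Lambda> by (simp add: \<mu>_def)
  \<comment> \<open>Clamping to \<open>{0..L}\<close> lets functions on the interval be treated as
    elements of the complete space \<open>bcontfun\<close> over the whole line.\<close>
  define p where "p s = max 0 (min L s)" for s :: real
  have p: "p s \<in> {0..L}" for s using L by (auto simp: p_def)
  have p_id: "p s = s" if "s \<in> {0..L}" for s using that by (auto simp: p_def)
  have p_cont: "continuous_on UNIV p" unfolding p_def by (intro continuous_intros)
  \<comment> \<open>The argument \<open>z\<close> stands for the weighted unknown
    \<open>exp (- \<mu> * t) * y t\<close>. \<open>I\<close> returns the unweighted right-hand side
    of the integral equation and \<open>T\<close> restores the weight.\<close>
  define I where "I z s = y0 + integral {0..s} (\<lambda>t. G t (exp (\<mu> * t) * z t))" for z s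
  define T where "T z s = exp (- \<mu> * p s) * I z (p s)" for z :: "real \<Rightarrow> real" and s
  have Gc: "continuous_on {0..L} (\<lambda>t. G t (exp (\<mu> * t) * z t))" if "continuous_on UNIV z" for z
    by (intro cont continuous_intros continuous_on_subset[OF that]) auto
  have I_deriv: "(I z has_real_derivative G s (exp (\<mu> * s) * z s)) (at s within {0..L})"
    if "continuous_on UNIV z" "s \<in> {0..L}" for z s
    unfolding I_def
    using integral_has_real_derivative[OF Gc[OF that(1)] that(2)]
    by (auto intro!: derivative_eq_intros)
  have I_cont: "continuous_on {0..L} (I z)" if "continuous_on UNIV z" for z
    by (rule DERIV_continuous_on[OF I_deriv[OF that]])
  have T_bcont: "T z \<in> bcontfun" if z: "continuous_on UNIV z" for z
  proof -
    have c: "continuous_on {0..L} (\<lambda>s. exp (- \<mu> * s) * I z s)"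
      by (intro continuous_intros I_cont[OF z])
    then have "continuous_on UNIV ((\<lambda>s. exp (- \<mu> * s) * I z s) \<circ> p)"
      by (intro continuous_on_compose[OF p_cont]) (use p in \<open>auto intro: continuous_on_subset\<close>)
    then have "continuous_on UNIV (T z)" by (simp add: T_def[abs_def] o_def)
    moreover have "bounded (range (T z))"
      using compact_imp_bounded[OF compact_continuous_image[OF c compact_Icc]]
      by (rule bounded_subset) (use p in \<open>auto simp: T_def\<close>)
    ultimately show ?thesis by (simp add: bcontfun_def)
  qed
  have cb: "continuous_on UNIV (apply_bcontfun u)" for u :: "(real, real) bcontfun"
    by (rule continuous_on_apply_bcontfun)
  define TT where "TT u = Bcontfun (T (apply_bcontfun u))" for u :: "(real, real) bcontfun"
  have TT: "apply_bcontfun (TT u) = T (apply_bcontfun u)" for u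
    using T_bcont[OF cb] by (simp add: TT_def Bcontfun_inverse)
  have contr: "dist (TT u) (TT v) \<le> (1/2) * dist u v" for u v
  proof (rule dist_bound)
    fix s :: real
    define r where "r = p s"
    have r: "r \<in> {0..L}" using p by (simp add: r_def)
    define e where "e = dist u v"
    have e: "\<bar>u t - v t\<bar> \<le> e" for t using dist_bounded[of u t v] by (simp add: e_def dist_real_def)
    have sub: "{0..r} \<subseteq> {0..L}" using r by auto
    have iu: "(\<lambda>t. G t (exp (\<mu> * t) * u t)) integrable_on {0..r}" 
      and iv: "(\<lambda>t. G t (exp (\<mu> * t) * v t)) integrable_on {0..r}"
      by (auto intro!: integrable_continuous_real continuous_on_subset[OF Gc[OF cb] sub])
    have ie: "((\<lambda>t. \<Lambda> * e * exp (\<mu> * t)) has_integral (e / 2 * exp (\<mu> * r) - e / 2 * exp (\<mu> * 0))) {0..r}"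
      using r \<Lambda> by (intro fundamental_theorem_of_calculus)
         (auto intro!: derivative_eq_intros simp: has_real_derivative_iff_has_vector_derivative[symmetric] \<mu>_def)
    have "\<bar>I u r - I v r\<bar> = \<bar>integral {0..r} (\<lambda>t. G t (exp (\<mu> * t) * u t) - G t (exp (\<mu> * t) * v t))\<bar>"
      unfolding I_def by (subst integral_diff[OF iu iv]) simp
    also have "\<dots> \<le> integral {0..r} (\<lambda>t. \<Lambda> * e * exp (\<mu> * t))"
    proof -
      have "norm (integral {0..r} (\<lambda>t. G t (exp (\<mu> * t) * u t) - G t (exp (\<mu> * t) * v t)))
         \<le> integral {0..r} (\<lambda>t. \<Lambda> * e * exp (\<mu> * t))"
      proof (rule integral_norm_bound_integral)
        show "(\<lambda>t. G t (exp (\<mu> * t) * u t) - G t (exp (\<mu> * t) * v t)) integrable_on {0..r}"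
          by (rule integrable_diff[OF iu iv])
        show "(\<lambda>t. \<Lambda> * e * exp (\<mu> * t)) integrable_on {0..r}" using ie by blast
        fix t assume "t \<in> {0..r}"
        then have "\<bar>G t (exp (\<mu> * t) * u t) - G t (exp (\<mu> * t) * v t)\<bar>
            \<le> \<Lambda> * \<bar>exp (\<mu> * t) * u t - exp (\<mu> * t) * v t\<bar>" using lip sub by blast
        also have "\<dots> = \<Lambda> * exp (\<mu> * t) * \<bar>u t - v t\<bar>"
          by (simp add: abs_mult flip: right_diff_distrib)
        also have "\<dots> \<le> \<Lambda> * exp (\<mu> * t) * e" using e \<Lambda> by (intro mult_left_mono) auto
        finally show "norm (G t (exp (\<mu> * t) * u t) - G t (exp (\<mu> * t) * v t)) \<le> \<Lambda> * e * exp (\<mu> * t)"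
          by (simp add: ac_simps)
      qed
      then show ?thesis by simp
    qed
    also have "\<dots> \<le> e / 2 * exp (\<mu> * r)"
      using integral_unique[OF ie] by (simp add: e_def)
    finally have "\<bar>I u r - I v r\<bar> \<le> e / 2 * exp (\<mu> * r)" .
    then have "exp (- \<mu> * r) * \<bar>I u r - I v r\<bar> \<le> exp (- \<mu> * r) * (e / 2 * exp (\<mu> * r))"
      by (intro mult_left_mono) auto
    also have "\<dots> = e / 2" by (simp add: exp_minus field_simps)
    finally show "dist (TT u s) (TT v s) \<le> (1/2) * dist u v"
      unfolding TT T_def r_def[symmetric] dist_real_def e_def
      by (simp add: abs_mult flip: right_diff_distrib)
  qed
  obtain u where u: "TT u = u"
    using banach_fix_type[of "1/2" TT] contr by auto
  define y where "y s = I u s" for s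
  have yu: "y s = exp (\<mu> * s) * u s" if "s \<in> {0..L}" for s
  proof -
    have "u s = T u s" using TT[of u] u by simp
    then show ?thesis using p_id[OF that] by (simp add: T_def y_def exp_minus field_simps)
  qed
  show thesis
  proof
    show "y 0 = y0" by (simp add: y_def I_def)
    fix s assume "s \<in> {0..L}"
    then show "(y has_real_derivative G s (y s)) (at s within {0..L})"
      using I_deriv[OF cb, of s u] yu[of s] unfolding y_def[abs_def] by simp
  qed
qed

section \<open>Orbits leaving a rest state\<close>

text \<open>The singularity at \<open>y = 0\<close> is cut off by \<open>max y \<epsilon>\<close>,
  which makes the right-hand side Lipschitz. The extra source \<open>M * \<epsilon>\<close> then
  keeps the solution above \<open>\<epsilon>\<close>, so the cut-off is never active and the uncut
  equation holds.\<close>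

lemma regularised_solution:
  fixes A h :: "real \<Rightarrow> real"
  assumes L: "0 \<le> L" and M: "0 < M" and \<epsilon>: "0 < \<epsilon>"
    and cA: "continuous_on {0..L} A" and ch: "continuous_on {0..L} h"
    and h: "\<And>s. s \<in> {0..L} \<Longrightarrow> 0 \<le> h s" and A: "\<And>s. s \<in> {0..L} \<Longrightarrow> \<bar>A s\<bar> \<le> M"
  obtains y where "y 0 = \<epsilon>" and "\<And>s. s \<in> {0..L} \<Longrightarrow> \<epsilon> \<le> y s"
    and "\<And>s. s \<in> {0..L} \<Longrightarrow>
      (y has_real_derivative A s + (h s + M * \<epsilon>) / y s) (at s within {0..L})"
proof -
  define G where "G s y = A s + (h s + M * \<epsilon>) / max y \<epsilon>" for s y
  obtain H where H: "\<And>s. s \<in> {0..L} \<Longrightarrow> h s \<le> H"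
    using compact_continuous_image[OF ch compact_Icc] compact_imp_bounded bounded_has_Sup(1)
    by (metis (no_types, lifting) image_eqI bdd_above.E compact_imp_bounded bounded_imp_bdd_above)
  have H0: "0 \<le> H" using H[of 0] h[of 0] L by auto
  define \<Lambda> where "\<Lambda> = (H + M * \<epsilon>) / \<epsilon>\<^sup>2"
  have H1: "0 < H + M * \<epsilon>" using H0 M \<epsilon> by (simp add: add_nonneg_pos)
  obtain y where y0: "y 0 = \<epsilon>"
    and y: "\<And>s. s \<in> {0..L} \<Longrightarrow> (y has_real_derivative G s (y s)) (at s within {0..L})"
  proof (rule picard_lindelof_interval[of L \<Lambda> G])
    show "0 < \<Lambda>" using H1 \<epsilon> by (simp add: \<Lambda>_def)
    show "continuous_on {0..L} (\<lambda>s. G s (y s))" if "continuous_on {0..L} y" for y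
      unfolding G_def using \<epsilon> by (intro continuous_intros cA ch that) (auto simp: max_def)
    fix s y z :: real assume s: "s \<in> {0..L}"
    define u v where "u = max y \<epsilon>" and "v = max z \<epsilon>"
    have uv: "\<epsilon> \<le> u" "\<epsilon> \<le> v" "\<bar>u - v\<bar> \<le> \<bar>y - z\<bar>" by (auto simp: u_def v_def)
    have pos: "0 < u" "0 < v" using uv \<epsilon> by auto
    have "\<epsilon>\<^sup>2 \<le> u * v" using uv \<epsilon> by (auto simp: power2_eq_square intro: mult_mono)
    have "G s y - G s z = (h s + M * \<epsilon>) * ((v - u) / (u * v))"
      using pos by (simp add: G_def u_def[symmetric] v_def[symmetric] field_simps)
    then have "\<bar>G s y - G s z\<bar> = (h s + M * \<epsilon>) * (\<bar>u - v\<bar> / (u * v))"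
      using pos h[OF s] M \<epsilon> by (simp add: abs_mult abs_minus_commute)
    also have "\<dots> \<le> (H + M * \<epsilon>) * (\<bar>y - z\<bar> / \<epsilon>\<^sup>2)"
      using pos h[OF s] M \<epsilon> H[OF s] H1 \<open>\<epsilon>\<^sup>2 \<le> u * v\<close> uv
      by (intro mult_mono frac_le) auto
    finally show "\<bar>G s y - G s z\<bar> \<le> \<Lambda> * \<bar>y - z\<bar>" by (simp add: \<Lambda>_def)
  qed (use L in auto)
  have yc: "continuous_on {0..L} y" by (rule DERIV_continuous_on[OF y])
  have ge: "\<epsilon> \<le> y s" if "s \<in> {0..L}" for s
  proof -
    have "0 \<le> y s - \<epsilon>"
    proof (rule nonneg_of_barrier[OF _ _ _ that])
      show "continuous_on {0..L} (\<lambda>s. y s - \<epsilon>)" by (intro continuous_intros yc)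
      fix r assume r: "0 < r" "r < L" "y r - \<epsilon> < 0"
      have "(y has_real_derivative G r (y r)) (at r)"
        using y[of r] r by (simp add: at_within_Icc_at)
      \<comment> \<open>Below \<open>\<epsilon>\<close> the denominator is
        \<open>\<epsilon>\<close>, so the quotient is at least \<open>M\<close>, which outweighs
        \<open>A\<close>.\<close>
      moreover have "0 \<le> G r (y r)"
        using r h[of r] A[of r] \<epsilon> by (simp add: G_def max_def add_divide_distrib abs_le_iff)
           (smt (verit) divide_nonneg_pos)
      ultimately show "\<exists>d\<ge>0. ((\<lambda>s. y s - \<epsilon>) has_real_derivative d) (at r)"
        by (auto intro!: exI[of _ "G r (y r)"] derivative_eq_intros)
    qed (simp add: y0)
    then show ?thesis by simp
  qed
  show thesis
    by (rule that[of y]) (use y0 ge y in \<open>simp_all add: G_def max_absorb1\<close>)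
qed

text \<open>
  \<open>half_sol A h L \<phi>\<close>: \<open>\<phi>\<close> is an orbit in the phase plane leaving the rest state
  \<open>\<phi> = 0\<close> at \<open>s = 0\<close>; no equation is imposed at \<open>L\<close>, where \<open>\<phi>\<close> may vanish again.
\<close>

definition half_sol :: "(real \<Rightarrow> real) \<Rightarrow> (real \<Rightarrow> real) \<Rightarrow> real \<Rightarrow> (real \<Rightarrow> real) \<Rightarrow> bool" where
  "half_sol A h L \<phi> \<longleftrightarrow> continuous_on {0..L} \<phi> \<and> \<phi> 0 = 0 \<and>
     (\<forall>s\<in>{0<..<L}. 0 < \<phi> s \<and> (\<phi> has_real_derivative A s + h s / \<phi> s) (at s))"

text \<open>The square of an orbit satisfies an equation without a quotient; since
  \<open>\<phi>\<close> is the square root of its square, the original equation returns wherever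
  \<open>\<phi>\<close> is positive, including one-sidedly at an end point.\<close>

lemma has_real_derivative_of_square:
  fixes \<phi> :: "real \<Rightarrow> real"
  assumes "((\<lambda>s. (\<phi> s)\<^sup>2) has_real_derivative 2 * d) (at s within S)"
    and "s \<in> S" and "0 < \<phi> s" and "\<And>t. t \<in> S \<Longrightarrow> 0 \<le> \<phi> t"
  shows "(\<phi> has_real_derivative d / \<phi> s) (at s within S)"
proof (rule has_field_derivative_transform_within[where d = 1])
  show "((\<lambda>s. sqrt ((\<phi> s)\<^sup>2)) has_real_derivative d / \<phi> s) (at s within S)"
    using assms(2-4)
    by (intro DERIV_cong[OF DERIV_chain2[OF DERIV_real_sqrt assms(1)]]) (auto simp: field_simps)
qed (use assms in auto)

text \<open>The regularised solutions decrease as \<open>\<epsilon>\<close> does. Their limit is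
  identified through the equation for the square,
  \<open>(\<phi>\<^sup>2)' = 2 (A \<phi> + h)\<close>, in integrated form, where dominated
  convergence applies despite the vanishing initial value. This equation is exported up to both end
  points because it gives the derivative of \<open>\<phi>\<close> at \<open>L\<close> when
  \<open>\<phi> L\<close> is positive.\<close>

lemma half_sol_exists:
  fixes A h :: "real \<Rightarrow> real"
  assumes L: "0 < L" and cA: "continuous_on {0..L} A" and ch: "continuous_on {0..L} h"
    and h: "\<And>s. s \<in> {0<..<L} \<Longrightarrow> 0 < h s" and h0: "0 \<le> h 0" "0 \<le> h L"
  obtains \<phi> where "half_sol A h L \<phi>" and "\<And>s. s \<in> {0..L} \<Longrightarrow> 0 \<le> \<phi> s"
    and "\<And>s. s \<in> {0..L} \<Longrightarrow>
      ((\<lambda>s. (\<phi> s)\<^sup>2) has_real_derivative 2 * (A s * \<phi> s + h s)) (at s within {0..L})"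
proof -
  have hn: "0 \<le> h s" if "s \<in> {0..L}" for s
    using h[of s] h0 that by (cases "s = 0 \<or> s = L") auto
  have "bounded (A ` {0..L})"
    by (intro compact_imp_bounded compact_continuous_image cA compact_Icc)
  then obtain M where M: "0 < M" "\<And>s. s \<in> {0..L} \<Longrightarrow> \<bar>A s\<bar> \<le> M"
    by (auto simp: bounded_pos)
  define \<epsilon> where "\<epsilon> n = inverse (real (Suc n))" for n
  have \<epsilon>: "0 < \<epsilon> n" "\<epsilon> (Suc n) \<le> \<epsilon> n" for n by (auto simp: \<epsilon>_def field_simps)
  have \<epsilon>_lim: "\<epsilon> \<longlonglongrightarrow> 0" unfolding \<epsilon>_def by (rule LIMSEQ_inverse_real_of_nat)
  have "\<exists>y. y 0 = \<epsilon> n \<and> (\<forall>s\<in>{0..L}. \<epsilon> n \<le> y s \<and>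
      (y has_real_derivative A s + (h s + M * \<epsilon> n) / y s) (at s within {0..L}))" for n
    by (rule regularised_solution[OF less_imp_le[OF L] M(1) \<epsilon>(1) cA ch hn M(2)]) blast+
  then obtain y where y0: "\<And>n. y n 0 = \<epsilon> n" and yge: "\<And>n s. s \<in> {0..L} \<Longrightarrow> \<epsilon> n \<le> y n s"
    and y: "\<And>n s. s \<in> {0..L} \<Longrightarrow>
       (y n has_real_derivative A s + (h s + M * \<epsilon> n) / y n s) (at s within {0..L})"
    by metis
  have yc: "continuous_on {0..L} (y n)" for n by (rule DERIV_continuous_on[OF y])
  have ypos: "0 < y n s" if "s \<in> {0..L}" for n s using yge[OF that] \<epsilon>(1) by (rule less_le_trans[rotated])
  \<comment> \<open>Wherever the order is violated, \<open>y n\<close> has the larger numerator and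
    the smaller denominator, so the difference cannot decrease there.\<close>
  have dec: "y (Suc n) s \<le> y n s" if "s \<in> {0..L}" for n s
  proof -
    have "0 \<le> y n s - y (Suc n) s"
    proof (rule nonneg_of_barrier[OF _ _ _ that])
      show "continuous_on {0..L} (\<lambda>s. y n s - y (Suc n) s)" by (intro continuous_intros yc)
      show "0 \<le> y n 0 - y (Suc n) 0" using \<epsilon> by (simp add: y0)
      fix r assume r: "0 < r" "r < L" "y n r - y (Suc n) r < 0"
      then have rr: "r \<in> {0..L}" by simp
      define d where "d = (h r + M * \<epsilon> n) / y n r - (h r + M * \<epsilon> (Suc n)) / y (Suc n) r"
      have "((\<lambda>s. y n s - y (Suc n) s) has_real_derivative d) (at r)"
        using y[OF rr, of n] y[OF rr, of "Suc n"] r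
        by (auto simp: at_within_Icc_at d_def intro!: derivative_eq_intros)
      moreover have "0 \<le> d"
        unfolding d_def using ypos[OF rr] r hn[OF rr] M(1) \<epsilon> mult_pos_pos[OF M(1) \<epsilon>(1), of n]
        by simp (intro frac_le add_mono mult_left_mono add_nonneg_nonneg; simp add: less_imp_le)
      ultimately show "\<exists>d\<ge>0. ((\<lambda>s. y n s - y (Suc n) s) has_real_derivative d) (at r)" by blast
    qed
    then show ?thesis by simp
  qed
  have decs: "decseq (\<lambda>n. y n s)" if "s \<in> {0..L}" for s
    using dec[OF that] by (simp add: decseq_Suc_iff)
  define \<phi> where "\<phi> s = lim (\<lambda>n. y n s)" for s
  have lim: "(\<lambda>n. y n s) \<longlonglongrightarrow> \<phi> s" if "s \<in> {0..L}" for s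
    using decseq_convergent[OF decs[OF that], of 0] ypos[OF that]
    unfolding \<phi>_def by (metis convergentI convergent_LIMSEQ_iff less_imp_le)
  have \<phi>n: "0 \<le> \<phi> s" if "s \<in> {0..L}" for s
    by (rule LIMSEQ_le_const[OF lim[OF that]]) (use ypos[OF that] in \<open>auto intro: less_imp_le\<close>)
  have \<phi>0: "\<phi> 0 = 0"
    using LIMSEQ_unique[OF lim[of 0]] \<epsilon>_lim L by (simp add: y0)
  \<comment> \<open>\<open>u n\<close> is the derivative of the square of \<open>y n\<close>, and
    \<open>v\<close> is its pointwise limit.\<close>
  define u where "u n s = 2 * (A s * y n s + h s + M * \<epsilon> n)" for n s
  define v where "v s = 2 * (A s * \<phi> s + h s)" for s
  have ysq: "(u n has_integral (y n s)\<^sup>2 - (\<epsilon> n)\<^sup>2) {0..s}" if s: "s \<in> {0..L}" for n s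
  proof -
    have "(u n has_integral (y n s)\<^sup>2 - (y n 0)\<^sup>2) {0..s}"
    proof (rule fundamental_theorem_of_calculus)
      fix r assume r: "r \<in> {0..s}"
      then have rr: "r \<in> {0..L}" using s by auto
      have "((\<lambda>s. (y n s)\<^sup>2) has_real_derivative u n r) (at r within {0..L})"
        using ypos[OF rr, of n]
        by (auto intro!: derivative_eq_intros y[OF rr] simp: u_def field_simps)
      then show "((\<lambda>s. (y n s)\<^sup>2) has_vector_derivative u n r) (at r within {0..s})"
        unfolding has_real_derivative_iff_has_vector_derivative
        by (rule has_vector_derivative_within_subset) (use s in auto)
    qed (use s in auto)
    then show ?thesis by (simp add: y0)
  qed
  have uc: "continuous_on {0..L} (u n)" for n
    unfolding u_def by (intro continuous_intros cA ch yc)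
  have ydom: "y n s \<le> y 0 s" if "s \<in> {0..L}" for n s
    using decs[OF that] by (simp add: decseq_def)
  have conv: "v integrable_on {0..s}" "(\<lambda>n. integral {0..s} (u n)) \<longlonglongrightarrow> integral {0..s} v"
    if s: "s \<in> {0..L}" for s
  proof -
    have sub: "{0..s} \<subseteq> {0..L}" using s by auto
    have 1: "u n integrable_on {0..s}" for n using ysq[OF s] by blast
    have 2: "(\<lambda>s. 2 * (M * y 0 s + h s + M * \<epsilon> 0)) integrable_on {0..s}"
      by (intro integrable_continuous_real continuous_on_subset[OF _ sub] continuous_intros ch yc)
    have 3: "(\<lambda>n. u n r) \<longlonglongrightarrow> v r" if "r \<in> {0..s}" for r
      unfolding u_def v_def using \<epsilon>_lim lim[of r] sub that by (auto intro!: tendsto_eq_intros)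
    have 4: "norm (u n r) \<le> 2 * (M * y 0 r + h r + M * \<epsilon> 0)" if "r \<in> {0..s}" for n r
    proof -
      have r: "r \<in> {0..L}" using sub that by auto
      have "\<bar>A r * y n r\<bar> \<le> M * y 0 r"
        using M(2)[OF r] ydom[OF r, of n] ypos[OF r, of n] M(1) unfolding abs_mult by (intro mult_mono) auto
      moreover have "\<epsilon> n \<le> \<epsilon> 0" by (simp add: \<epsilon>_def field_simps)
      then have "M * \<epsilon> n \<le> M * \<epsilon> 0" using M(1) by simp
      moreover have "0 \<le> M * \<epsilon> n" using M(1) \<epsilon>(1)[of n] by simp
      ultimately show ?thesis
        unfolding u_def using hn[OF r] by (simp add: abs_le_iff)
    qed
    show "v integrable_on {0..s}" "(\<lambda>n. integral {0..s} (u n)) \<longlonglongrightarrow> integral {0..s} v"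
      using dominated_convergence[OF 1 2 4 3] by blast+
  qed
  have sq: "(\<phi> s)\<^sup>2 = integral {0..s} v" if s: "s \<in> {0..L}" for s
  proof (rule LIMSEQ_unique)
    show "(\<lambda>n. integral {0..s} (u n)) \<longlonglongrightarrow> integral {0..s} v" using conv[OF s] by blast
    have "(\<lambda>n. (y n s)\<^sup>2 - (\<epsilon> n)\<^sup>2) \<longlonglongrightarrow> (\<phi> s)\<^sup>2"
      using lim[OF s] \<epsilon>_lim by (auto intro!: tendsto_eq_intros)
    then show "(\<lambda>n. integral {0..s} (u n)) \<longlonglongrightarrow> (\<phi> s)\<^sup>2"
      using integral_unique[OF ysq[OF s]] by simp
  qed
  have "continuous_on {0..L} (\<lambda>s. integral {0..s} v)"
    using conv[of L] L by (intro indefinite_integral_continuous_1) auto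
  then have "continuous_on {0..L} (\<lambda>s. sqrt (integral {0..s} v))"
    by (intro continuous_intros)
  then have \<phi>c: "continuous_on {0..L} \<phi>"
    by (rule continuous_on_eq) (use \<phi>n in \<open>simp flip: sq\<close>)
  have vc: "continuous_on {0..L} v" unfolding v_def by (intro continuous_intros cA ch \<phi>c)
  have dsq: "((\<lambda>s. (\<phi> s)\<^sup>2) has_real_derivative v s) (at s within {0..L})" if s: "s \<in> {0..L}" for s
    by (rule has_field_derivative_transform_within[OF integral_has_real_derivative[OF vc s], where d = 1])
       (use s sq in auto)
  \<comment> \<open>At an interior zero the square would be minimal, so its derivative
    \<open>2 * h s\<close> would vanish.\<close>
  have pos: "0 < \<phi> s" if s: "s \<in> {0<..<L}" for s
  proof (rule ccontr)
    assume "\<not> 0 < \<phi> s"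
    then have z: "\<phi> s = 0" using \<phi>n[of s] s by auto
    have "((\<lambda>s. (\<phi> s)\<^sup>2) has_real_derivative v s) (at s)"
      using dsq[of s] s by (simp add: at_within_Icc_at)
    from DERIV_local_min[OF this, of 1] have "v s = 0" by (simp add: z)
    then show False using h[OF s] by (simp add: v_def z)
  qed
  show thesis
  proof (rule that[of \<phi>])
    show "half_sol A h L \<phi>"
      unfolding half_sol_def
    proof (intro conjI ballI)
      fix s assume s: "s \<in> {0<..<L}"
      show "0 < \<phi> s" by (rule pos[OF s])
      have "(\<phi> has_real_derivative (A s * \<phi> s + h s) / \<phi> s) (at s within {0..L})"
        by (rule has_real_derivative_of_square) (use s pos dsq \<phi>n in \<open>auto simp: v_def\<close>)
      then show "(\<phi> has_real_derivative A s + h s / \<phi> s) (at s)"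
        using s pos[OF s] by (simp add: at_within_Icc_at add_divide_distrib)
    qed (use \<phi>c \<phi>0 in auto)
  qed (use \<phi>n dsq in \<open>auto simp: v_def\<close>)
qed

section \<open>Comparison of orbits and their behaviour at the end points\<close>

lemma half_solD:
  assumes "half_sol A h L \<phi>"
  shows "continuous_on {0..L} \<phi>" and "\<phi> 0 = 0"
    and "\<And>s. 0 < s \<Longrightarrow> s < L \<Longrightarrow> 0 < \<phi> s"
    and "\<And>s. 0 < s \<Longrightarrow> s < L \<Longrightarrow> (\<phi> has_real_derivative A s + h s / \<phi> s) (at s)"
  using assms by (auto simp: half_sol_def)

lemma half_sol_mono_on:
  assumes "half_sol A h L \<phi>" and "L' \<le> L" shows "half_sol A h L' \<phi>"
  using assms by (auto simp: half_sol_def intro: continuous_on_subset)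

text \<open>
  Since \<open>h / \<phi>\<close> decreases in \<open>\<phi>\<close>, two orbits cannot separate faster than their drifts do,
  even though the equation is singular at the common initial point.
\<close>

lemma half_sol_le:
  assumes \<phi>: "half_sol A h L \<phi>" and \<psi>: "half_sol B h L \<psi>" and \<delta>: "0 \<le> \<delta>"
    and h: "\<And>s. s \<in> {0<..<L} \<Longrightarrow> 0 \<le> h s" and AB: "\<And>s. s \<in> {0<..<L} \<Longrightarrow> A s \<le> B s + \<delta>"
    and s: "s \<in> {0..L}"
  shows "\<phi> s \<le> \<psi> s + \<delta> * s"
proof -
  note p = half_solD[OF \<phi>] and q = half_solD[OF \<psi>]
  have "0 \<le> \<psi> s + \<delta> * s - \<phi> s"
  proof (rule nonneg_of_barrier[OF _ _ _ s])
    show "continuous_on {0..L} (\<lambda>s. \<psi> s + \<delta> * s - \<phi> s)" by (intro continuous_intros p q)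
    fix r assume r: "0 < r" "r < L" "\<psi> r + \<delta> * r - \<phi> r < 0"
    have "0 \<le> \<delta> * r" using \<delta> r by simp
    then have "\<psi> r \<le> \<phi> r" using r by linarith
    then have "h r / \<phi> r \<le> h r / \<psi> r" using q(3)[of r] r h[of r] by (intro divide_left_mono) auto
    then have "0 \<le> B r + h r / \<psi> r + \<delta> - (A r + h r / \<phi> r)" using AB[of r] r by auto
    moreover have "((\<lambda>s. \<psi> s + \<delta> * s - \<phi> s) has_real_derivative B r + h r / \<psi> r + \<delta> - (A r + h r / \<phi> r)) (at r)"
      using r by (auto intro!: derivative_eq_intros p(4) q(4))
    ultimately show "\<exists>d\<ge>0. ((\<lambda>s. \<psi> s + \<delta> * s - \<phi> s) has_real_derivative d) (at r)" by blast
  qed (simp add: p q)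
  then show ?thesis by simp
qed

lemma half_sol_unique:
  assumes "half_sol A h L \<phi>" and "half_sol A h L \<psi>"
    and "\<And>s. s \<in> {0<..<L} \<Longrightarrow> 0 \<le> h s" and "s \<in> {0..L}"
  shows "\<phi> s = \<psi> s"
  using half_sol_le[of A h L \<phi> A \<psi> 0 s] half_sol_le[of A h L \<psi> A \<phi> 0 s] assms by force

text \<open>Weak comparison gives \<open>\<phi> \<le> \<psi>\<close>. If the end values agreed, the
  quotients would cancel in the limit at \<open>L\<close> (where positivity keeps them continuous),
  so \<open>\<psi> - \<phi>\<close> would have slope near \<open>\<delta> > 0\<close> just before
  \<open>L\<close> and be negative there.\<close>

lemma half_sol_less_at_end:
  assumes \<phi>: "half_sol A h L \<phi>" and \<psi>: "half_sol (\<lambda>s. A s + \<delta>) h L \<psi>" and \<delta>: "0 < \<delta>" and L: "0 < L"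
    and h: "\<And>s. s \<in> {0<..<L} \<Longrightarrow> 0 \<le> h s" and ch: "continuous_on {0..L} h" and end_pos: "0 < \<phi> L"
  shows "\<phi> L < \<psi> L"
proof (rule ccontr)
  assume "\<not> \<phi> L < \<psi> L"
  note p = half_solD[OF \<phi>] and q = half_solD[OF \<psi>]
  have le: "\<phi> s \<le> \<psi> s" if "s \<in> {0..L}" for s
    using half_sol_le[OF \<phi> \<psi> order.refl h _ that] \<delta> by simp
  then have eq: "\<phi> L = \<psi> L" using \<open>\<not> \<phi> L < \<psi> L\<close> L le[of L] by (intro antisym) auto
  have "((\<lambda>s. \<delta> + (h s / \<psi> s - h s / \<phi> s)) \<longlongrightarrow> \<delta> + (h L / \<psi> L - h L / \<phi> L)) (at_left L)"
    using p(1) q(1) ch L end_pos eq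
    by (intro tendsto_intros) (auto simp: continuous_on at_within_Icc_at_left dest!: bspec[of _ _ L])
  then have "((\<lambda>s. \<delta> + (h s / \<psi> s - h s / \<phi> s)) \<longlongrightarrow> \<delta>) (at_left L)" by (simp add: eq)
  from order_tendstoD(1)[OF this \<delta>] have "\<forall>\<^sub>F s in at_left L. 0 < \<delta> + (h s / \<psi> s - h s / \<phi> s)" .
  then obtain l where l: "l < L" "\<And>s. l < s \<Longrightarrow> s < L \<Longrightarrow> 0 < \<delta> + (h s / \<psi> s - h s / \<phi> s)"
    unfolding eventually_at_left_field by blast
  \<comment> \<open>Any point of \<open>(l, L)\<close> that is also positive would do.\<close>
  define a where "a = max (L/2) ((l + L)/2)"
  have a: "l < a" "a < L" "0 < a" using l L by (auto simp: a_def max_def field_simps)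
  have "\<psi> a - \<phi> a < \<psi> L - \<phi> L"
  proof (rule DERIV_pos_imp_increasing_open[OF a(2)])
    show "continuous_on {a..L} (\<lambda>s. \<psi> s - \<phi> s)"
      using a by (intro continuous_intros continuous_on_subset[OF p(1)] continuous_on_subset[OF q(1)]) auto
    fix s assume s: "a < s" "s < L"
    have "((\<lambda>s. \<psi> s - \<phi> s) has_real_derivative (A s + \<delta> + h s / \<psi> s - (A s + h s / \<phi> s))) (at s)"
      using s a by (auto intro!: derivative_eq_intros p(4) q(4))
    then show "\<exists>y. ((\<lambda>s. \<psi> s - \<phi> s) has_real_derivative y) (at s) \<and> 0 < y"
      using l(2)[of s] s a by force
  qed
  then show False using le[of a] a eq by simp
qed

text \<open>The source term only adds to the slope. This bound makes the end value of an orbit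
  arbitrarily large when a large constant is added to the drift.\<close>

lemma half_sol_ge_linear:
  assumes \<phi>: "half_sol A h L \<phi>" and h: "\<And>s. s \<in> {0<..<L} \<Longrightarrow> 0 \<le> h s"
    and A: "\<And>s. s \<in> {0<..<L} \<Longrightarrow> m \<le> A s" and s: "s \<in> {0..L}"
  shows "m * s \<le> \<phi> s"
proof -
  note p = half_solD[OF \<phi>]
  have "0 \<le> \<phi> s - m * s"
  proof (rule nonneg_of_barrier[OF _ _ _ s])
    show "continuous_on {0..L} (\<lambda>s. \<phi> s - m * s)" by (intro continuous_intros p)
    fix r assume r: "0 < r" "r < L"
    have "((\<lambda>s. \<phi> s - m * s) has_real_derivative A r + h r / \<phi> r - m) (at r)"
      using r by (auto intro!: derivative_eq_intros p(4))
    moreover have "0 \<le> A r + h r / \<phi> r - m" using r h[of r] A[of r] p(3)[of r] by (simp add: add_increasing2 )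
    ultimately show "\<exists>d\<ge>0. ((\<lambda>s. \<phi> s - m * s) has_real_derivative d) (at r)" by blast
  qed (simp add: p)
  then show ?thesis by simp
qed

text \<open>If \<open>\<phi>\<close> vanished at \<open>L\<close>, then close to \<open>L\<close>
  the source would be at least a multiple of \<open>L - s\<close>, and dividing it by the small
  \<open>\<phi>\<close> would outweigh any drift as negative as a multiple of \<open>L - s\<close>.
  So \<open>\<phi>\<close> would increase up to its value at \<open>L\<close>, which is impossible
  after being positive.\<close>

lemma half_sol_pos_at_end:
  assumes \<phi>: "half_sol A h L \<phi>" and L: "0 < L"
    and A: "(A has_real_derivative A') (at L within {0..L})" "0 \<le> A L"
    and h: "(h has_real_derivative h') (at L within {0..L})" "h' < 0" "h L = 0"
  shows "0 < \<phi> L"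
proof (rule ccontr)
  note p = half_solD[OF \<phi>]
  assume "\<not> 0 < \<phi> L"
  \<comment> \<open>Slack in both slopes: near \<open>L\<close>, \<open>h s > k * (L - s)\<close>
    and \<open>A s > - K * (L - s)\<close>. The source wins once
    \<open>\<phi> s < k / K\<close>.\<close>
  define k K where "k = - h' / 2" and "K = \<bar>A'\<bar> + 1"
  have k: "0 < k" using h by (simp add: k_def)
  have K: "0 < K" by (simp add: K_def)
  have W: "at L within {0..L} = at_left L" using L by (rule at_within_Icc_at_left)
  have "((\<lambda>s. (h s - h L) / (s - L)) \<longlongrightarrow> h') (at_left L)" and "((\<lambda>s. (A s - A L) / (s - L)) \<longlongrightarrow> A') (at_left L)"
    using h(1) A(1) by (simp_all add: has_field_derivative_iff W)
  moreover have "h' < - k" "A' < K" using h by (auto simp: k_def K_def)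
  ultimately have "\<forall>\<^sub>F s in at_left L. (h s - h L) / (s - L) < - k" "\<forall>\<^sub>F s in at_left L. (A s - A L) / (s - L) < K"
    by (auto dest: order_tendstoD)
  moreover have "(\<phi> \<longlongrightarrow> \<phi> L) (at_left L)"
    using p(1) L by (auto simp: continuous_on W dest!: bspec[of _ _ L])
  then have "\<forall>\<^sub>F s in at_left L. \<phi> s < k / K"
    by (rule order_tendstoD) (use \<open>\<not> 0 < \<phi> L\<close> k K in \<open>auto intro: le_less_trans[of _ 0]\<close>)
  moreover have "\<forall>\<^sub>F s in at_left L. 0 < s \<and> s < L"
    using L by (auto simp: eventually_at_left_field)
  ultimately have "\<forall>\<^sub>F s in at_left L. 0 < s \<and> s < L \<and> \<phi> s < k / K \<and> 0 < A s + h s / \<phi> s"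
  proof eventually_elim
    case (elim s)
    then have "k * (L - s) < h s" "- K * (L - s) < A s"
      using h(3) A(2) by (auto simp: field_simps)
    have \<phi>s: "0 < \<phi> s" using p(3) elim by simp
    have "K * \<phi> s * (L - s) \<le> k * (L - s)" using elim K by (intro mult_right_mono) (auto simp: field_simps)
    then have "K * (L - s) \<le> h s / \<phi> s" using \<open>k * (L - s) < h s\<close> \<phi>s by (simp add: field_simps)
    then show ?case using elim \<open>- K * (L - s) < A s\<close> by simp
  qed
  then obtain l where l: "l < L" "\<And>s. l < s \<Longrightarrow> s < L \<Longrightarrow> 0 < s \<and> 0 < A s + h s / \<phi> s"
    unfolding eventually_at_left_field by blast
  define a where "a = (l + L) / 2"
  have a: "l < a" "a < L" using l by (auto simp: a_def)
  have "0 < a" using l(2)[of a] a by simp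
  have "\<phi> a < \<phi> L"
  proof (rule DERIV_pos_imp_increasing_open[OF a(2)])
    show "continuous_on {a..L} \<phi>" using \<open>0 < a\<close> by (intro continuous_on_subset[OF p(1)]) auto
    fix s assume s: "a < s" "s < L"
    then show "\<exists>y. (\<phi> has_real_derivative y) (at s) \<and> 0 < y"
      using p(4)[of s] l(2)[of s] a by auto
  qed
  then show False using p(3)[of a] \<open>0 < a\<close> a \<open>\<not> 0 < \<phi> L\<close> by simp
qed

text \<open>
  Comparison with the lines \<open>\<mu> s\<close>, which are super- or subsolutions near \<open>0\<close> according to
  whether \<open>\<mu>\<close> lies above or below the positive root \<open>m\<close>.
\<close>

lemma half_sol_slope:
  assumes \<phi>: "half_sol A h L \<phi>" and L: "0 < L"
    and A: "(A \<longlongrightarrow> a) (at_right 0)" and h: "((\<lambda>s. h s / s) \<longlongrightarrow> k) (at_right 0)"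
    and k: "0 < k" and m: "0 < m" "m\<^sup>2 = a * m + k"
  shows "((\<lambda>s. \<phi> s / s) \<longlongrightarrow> m) (at_right 0)"
proof (rule order_tendstoI)
  note p = half_solD[OF \<phi>]
  have lim: "((\<lambda>s. A s + (h s / s) / \<mu>) \<longlongrightarrow> a + k / \<mu>) (at_right 0)" if "0 < \<mu>" for \<mu>
    using that by (intro tendsto_intros A h) auto
  \<comment> \<open>\<open>m\<close> is the fixed point of the decreasing map taking
    \<open>\<mu>\<close> to \<open>a + k / \<mu>\<close>, the limiting right-hand side along the
    line of slope \<open>\<mu>\<close>. Hence that slope is below \<open>\<mu>\<close> for
    \<open>\<mu> > m\<close> and above it for \<open>\<mu> < m\<close>.\<close>
  have m': "m = a + k / m" using m by (simp add: field_simps power2_eq_square)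
  have hpos: "\<forall>\<^sub>F s in at_right 0. 0 < h s / s" using order_tendstoD(1)[OF h k] .
  show "\<forall>\<^sub>F s in at_right 0. \<phi> s / s < x" if "m < x" for x
  proof -
    define \<mu> where "\<mu> = (m + x) / 2"
    have \<mu>: "m < \<mu>" "\<mu> < x" "0 < \<mu>" using that m by (auto simp: \<mu>_def)
    have "k / \<mu> < k / m" using \<mu> m k by (simp add: frac_less2)
    then have "a + k / \<mu> < \<mu>" using m' \<mu> by linarith
    with lim[OF \<mu>(3)] have "\<forall>\<^sub>F s in at_right 0. A s + (h s / s) / \<mu> < \<mu>" by (rule order_tendstoD)
    with hpos have "\<forall>\<^sub>F s in at_right 0. 0 < h s / s \<and> A s + (h s / s) / \<mu> < \<mu>" by eventually_elim simp
    then obtain d where d: "0 < d" "\<And>s. 0 < s \<Longrightarrow> s < d \<Longrightarrow> 0 < h s / s \<and> A s + (h s / s) / \<mu> < \<mu>"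
      unfolding eventually_at_right_field by blast
    define e where "e = min d L"
    have e: "0 < e" "e \<le> d" "e \<le> L" using d L by (auto simp: e_def)
    have "0 \<le> \<mu> * s - \<phi> s" if "s \<in> {0..e}" for s
    proof (rule nonneg_of_barrier[OF _ _ _ that])
      show "continuous_on {0..e} (\<lambda>s. \<mu> * s - \<phi> s)" using e by (intro continuous_intros continuous_on_subset[OF p(1)]) auto
      fix r assume r: "0 < r" "r < e" "\<mu> * r - \<phi> r < 0"
      have "0 < h r" using d(2)[of r] r e by (simp add: zero_less_divide_iff)
      then have "h r / \<phi> r \<le> h r / (\<mu> * r)" using r \<mu> e p(3)[of r] by (intro divide_left_mono) auto
      then have "0 \<le> \<mu> - (A r + h r / \<phi> r)" using d(2)[of r] r e by (simp add: mult.commute)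
      moreover have "((\<lambda>s. \<mu> * s - \<phi> s) has_real_derivative \<mu> - (A r + h r / \<phi> r)) (at r)"
        using r e by (auto intro!: derivative_eq_intros p(4))
      ultimately show "\<exists>d\<ge>0. ((\<lambda>s. \<mu> * s - \<phi> s) has_real_derivative d) (at r)" by blast
    qed (simp add: p)
    then have "\<phi> s / s < x" if "0 < s" "s < e" for s
      using that \<mu> by (simp add: field_simps) (smt (verit) atLeastAtMost_iff mult_strict_right_mono mult.commute)
    then show ?thesis unfolding eventually_at_right_field using e by blast
  qed
  show "\<forall>\<^sub>F s in at_right 0. x < \<phi> s / s" if "x < m" for x
  proof -
    \<comment> \<open>The bound \<open>x\<close> may be negative; the maximum keeps
      \<open>\<mu>\<close> positive.\<close>
    define \<mu> where "\<mu> = (max 0 x + m) / 2"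
    have \<mu>: "\<mu> < m" "x < \<mu>" "0 < \<mu>" using that m by (auto simp: \<mu>_def)
    have "k / m < k / \<mu>" using \<mu> m k by (simp add: frac_less2)
    then have "\<mu> < a + k / \<mu>" using m' \<mu> by linarith
    with lim[OF \<mu>(3)] have "\<forall>\<^sub>F s in at_right 0. \<mu> < A s + (h s / s) / \<mu>" by (rule order_tendstoD)
    with hpos have "\<forall>\<^sub>F s in at_right 0. 0 < h s / s \<and> \<mu> < A s + (h s / s) / \<mu>" by eventually_elim simp
    then obtain d where d: "0 < d" "\<And>s. 0 < s \<Longrightarrow> s < d \<Longrightarrow> 0 < h s / s \<and> \<mu> < A s + (h s / s) / \<mu>"
      unfolding eventually_at_right_field by blast
    define e where "e = min d L"
    have e: "0 < e" "e \<le> d" "e \<le> L" using d L by (auto simp: e_def)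
    have "0 \<le> \<phi> s - \<mu> * s" if "s \<in> {0..e}" for s
    proof (rule nonneg_of_barrier[OF _ _ _ that])
      show "continuous_on {0..e} (\<lambda>s. \<phi> s - \<mu> * s)" using e by (intro continuous_intros continuous_on_subset[OF p(1)]) auto
      fix r assume r: "0 < r" "r < e" "\<phi> r - \<mu> * r < 0"
      have "0 < h r" using d(2)[of r] r e by (simp add: zero_less_divide_iff)
      then have "h r / (\<mu> * r) \<le> h r / \<phi> r" using r \<mu> e p(3)[of r] by (intro divide_left_mono) auto
      then have "0 \<le> A r + h r / \<phi> r - \<mu>" using d(2)[of r] r e by (simp add: mult.commute)
      moreover have "((\<lambda>s. \<phi> s - \<mu> * s) has_real_derivative A r + h r / \<phi> r - \<mu>) (at r)"
        using r e by (auto intro!: derivative_eq_intros p(4))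
      ultimately show "\<exists>d\<ge>0. ((\<lambda>s. \<phi> s - \<mu> * s) has_real_derivative d) (at r)" by blast
    qed (simp add: p)
    then have "x < \<phi> s / s" if "0 < s" "s < e" for s
      using that \<mu> by (simp add: field_simps) (smt (verit) atLeastAtMost_iff mult_strict_right_mono mult.commute)
    then show ?thesis unfolding eventually_at_right_field using e by blast
  qed
qed

section \<open>Matching the two orbits\<close>

text \<open>Collects what shooting needs about the end value as a function of a constant
  \<open>c\<close> added to the drift. Comparison gives Lipschitz continuity and monotonicity in
  \<open>c\<close>. The derivative at \<open>L\<close> is just the drift there, because the source
  vanishes at \<open>L\<close>.\<close>

lemma shooting_family:
  fixes \<beta> h :: "real \<Rightarrow> real"
  assumes L: "0 < L" and c\<beta>: "continuous_on {0..L} \<beta>" and ch: "continuous_on {0..L} h"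
    and h: "\<And>s. s \<in> {0<..<L} \<Longrightarrow> 0 < h s" and h0: "h 0 = 0" and hL: "h L = 0"
    and \<beta>d: "(\<beta> has_real_derivative \<beta>') (at L within {0..L})"
    and hd: "(h has_real_derivative h') (at L within {0..L})" "h' < 0"
  obtains \<Phi> :: "real \<Rightarrow> real \<Rightarrow> real" and M :: real
  where "\<And>c. half_sol (\<lambda>s. \<beta> s + c) h L (\<Phi> c)"
    and "continuous_on UNIV (\<lambda>c. \<Phi> c L)" and "mono (\<lambda>c. \<Phi> c L)"
    and "\<And>c. 0 \<le> \<Phi> c L" and "\<And>c. (c - M) * L \<le> \<Phi> c L"
    and "\<And>c. 0 \<le> \<beta> L + c \<Longrightarrow> 0 < \<Phi> c L"
    and "\<And>c. 0 < \<Phi> c L \<Longrightarrow> (\<Phi> c has_real_derivative \<beta> L + c) (at L within {0..L})"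
proof -
  have "\<exists>\<phi>. half_sol (\<lambda>s. \<beta> s + c) h L \<phi> \<and> (\<forall>s\<in>{0..L}. 0 \<le> \<phi> s \<and>
      ((\<lambda>s. (\<phi> s)\<^sup>2) has_real_derivative 2 * ((\<beta> s + c) * \<phi> s + h s)) (at s within {0..L}))" for c
    by (rule half_sol_exists[OF L _ ch h, of "\<lambda>s. \<beta> s + c"]) (use h0 hL in \<open>auto intro!: continuous_intros c\<beta>\<close>)
  then obtain \<Phi> where \<Phi>: "\<And>c. half_sol (\<lambda>s. \<beta> s + c) h L (\<Phi> c)"
    and \<Phi>n: "\<And>c s. s \<in> {0..L} \<Longrightarrow> 0 \<le> \<Phi> c s"
    and \<Phi>d: "\<And>c s. s \<in> {0..L} \<Longrightarrow> 
      ((\<lambda>s. (\<Phi> c s)\<^sup>2) has_real_derivative 2 * ((\<beta> s + c) * \<Phi> c s + h s)) (at s within {0..L})"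
    by metis
  have "bounded (\<beta> ` {0..L})"
    by (intro compact_imp_bounded compact_continuous_image c\<beta> compact_Icc)
  then obtain M where M: "\<And>s. s \<in> {0..L} \<Longrightarrow> \<bar>\<beta> s\<bar> \<le> M"
    unfolding bounded_real by blast
  have hn: "0 \<le> h s" if "s \<in> {0<..<L}" for s using h[OF that] by simp
  have lip: "\<Phi> c L \<le> \<Phi> d L + \<bar>c - d\<bar> * L" for c d
    by (rule half_sol_le[OF \<Phi> \<Phi> _ hn]) (use L in auto)
  show thesis
  proof (rule that[of \<Phi> M])
    have "L-lipschitz_on UNIV (\<lambda>c. \<Phi> c L)"
    proof (rule lipschitz_onI)
      show "dist (\<Phi> c L) (\<Phi> d L) \<le> L * dist c d" for c d
        using lip[of c d] lip[of d c] by (auto simp: dist_real_def abs_minus_commute mult.commute abs_le_iff)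
    qed (use L in simp)
    then show "continuous_on UNIV (\<lambda>c. \<Phi> c L)" by (rule lipschitz_on_continuous_on)
    show "mono (\<lambda>c. \<Phi> c L)"
    proof (rule monoI)
      show "\<Phi> c L \<le> \<Phi> d L" if "c \<le> d" for c d
        using half_sol_le[OF \<Phi>[of c] \<Phi>[of d] order.refl hn, of L] that L by simp
    qed
    show "(c - M) * L \<le> \<Phi> c L" for c
    proof (rule half_sol_ge_linear[OF \<Phi> hn])
      show "c - M \<le> \<beta> s + c" if "s \<in> {0<..<L}" for s using M[of s] that by auto
    qed (use L in auto)
    show "0 < \<Phi> c L" if "0 \<le> \<beta> L + c" for c
    proof (rule half_sol_pos_at_end[OF \<Phi> L _ that hd hL])
      show "((\<lambda>s. \<beta> s + c) has_real_derivative \<beta>') (at L within {0..L})"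
        by (auto intro!: derivative_eq_intros \<beta>d)
    qed
    show "(\<Phi> c has_real_derivative \<beta> L + c) (at L within {0..L})" if "0 < \<Phi> c L" for c
    proof -
      have "(\<Phi> c has_real_derivative ((\<beta> L + c) * \<Phi> c L + h L) / \<Phi> c L) (at L within {0..L})"
        by (rule has_real_derivative_of_square) (use L that \<Phi>n \<Phi>d in auto)
      then show ?thesis using that by (simp add: hL)
    qed
  qed (use \<Phi> \<Phi>n L in auto)
qed

text \<open>Serves to join the one-sided derivatives of the two orbits at \<open>q\<close>.\<close>

lemma has_real_derivative_within_Un:
  assumes "(\<phi> has_real_derivative d) (at x within S)" and "(\<phi> has_real_derivative d) (at x within T)"
  shows "(\<phi> has_real_derivative d) (at x within S \<union> T)"
  using filterlim_sup[OF assms[unfolded has_field_derivative_iff]]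
  unfolding has_field_derivative_iff at_within_union[symmetric] .

text \<open>The connection between the two rest states in the phase plane, with the flux as
  ordinate. Since \<open>V' = 2 \<phi> / \<sigma>\<^sup>2\<close>, the quotient
  \<open>F / \<phi>\<close> is \<open>f / V'\<close>.\<close>

definition wave_orbit :: "(real \<Rightarrow> real) \<Rightarrow> (real \<Rightarrow> real) \<Rightarrow> real \<Rightarrow> (real \<Rightarrow> real) \<Rightarrow> bool" where
  "wave_orbit b F c \<phi> \<longleftrightarrow> continuous_on {0..1} \<phi> \<and> \<phi> 0 = 0 \<and> \<phi> 1 = 0 \<and>
     (\<forall>s\<in>{0<..<1}. 0 < \<phi> s \<and> (\<phi> has_real_derivative b s - c - F s / \<phi> s) (at s))"

lemma wave_orbitD:
  assumes "wave_orbit b F c \<phi>"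
  shows "continuous_on {0..1} \<phi>" and "\<phi> 0 = 0" and "\<phi> 1 = 0"
    and "\<And>s. 0 < s \<Longrightarrow> s < 1 \<Longrightarrow> 0 < \<phi> s"
    and "\<And>s. 0 < s \<Longrightarrow> s < 1 \<Longrightarrow> (\<phi> has_real_derivative b s - c - F s / \<phi> s) (at s)"
  using assms by (auto simp: wave_orbit_def)

text \<open>The source \<open>- F\<close> has the favourable sign only on \<open>(0,q)\<close>. The
  uniqueness argument restricts to \<open>{0..q}\<close>, whereas the slope at \<open>0\<close>
  depends on the sign near \<open>0\<close> alone.\<close>

lemma wave_orbit_left:
  assumes "wave_orbit b F c \<phi>"
  shows "half_sol (\<lambda>s. b s + - c) (\<lambda>s. - F s) 1 \<phi>"
  using assms by (auto simp: wave_orbit_def half_sol_def)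

text \<open>Reflection reverses the sign of the derivative, so the speed enters the drift with the
  opposite sign and the source becomes positive near the end state \<open>1\<close>.\<close>

lemma wave_orbit_right:
  assumes "wave_orbit b F c \<phi>"
  shows "half_sol (\<lambda>t. - b (1 - t) + c) (\<lambda>t. F (1 - t)) 1 (\<lambda>t. \<phi> (1 - t))"
  unfolding half_sol_def
proof (intro conjI ballI)
  note p = wave_orbitD[OF assms]
  show "continuous_on {0..1} (\<lambda>t. \<phi> (1 - t))"
    by (rule continuous_on_compose2[OF p(1)]) (auto intro!: continuous_intros)
  fix t :: real assume t: "t \<in> {0<..<1}"
  then show "0 < \<phi> (1 - t)" using p(4) by simp
  have "((\<lambda>t. \<phi> (1 - t)) has_real_derivative (b (1 - t) - c - F (1 - t) / \<phi> (1 - t)) * - 1) (at t)"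
    by (rule DERIV_chain2[OF p(5)]) (use t in \<open>auto intro!: derivative_eq_intros\<close>)
  then show "((\<lambda>t. \<phi> (1 - t)) has_real_derivative - b (1 - t) + c + F (1 - t) / \<phi> (1 - t)) (at t)"
    by (rule DERIV_cong) simp
qed (use wave_orbitD(3)[OF assms] in simp)

text \<open>Shooting from both ends to \<open>q\<close>: the orbit from \<open>0\<close> has drift
  \<open>b - c\<close> and the reflected orbit from \<open>1\<close> has drift
  \<open>- b + c\<close>. The intermediate value theorem in \<open>c\<close> matches their values at
  \<open>q\<close>.\<close>

lemma wave_orbit_exists:
  fixes b F :: "real \<Rightarrow> real"
  assumes q: "q \<in> {0<..<1}" and cb: "continuous_on {0..1} b" and cF: "continuous_on {0..1} F"
    and F0: "F 0 = 0" "F q = 0" "F 1 = 0"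
    and Fneg: "\<And>s. s \<in> {0<..<q} \<Longrightarrow> F s < 0" and Fpos: "\<And>s. s \<in> {q<..<1} \<Longrightarrow> 0 < F s"
    and bd: "(b has_real_derivative b') (at q)" and Fd: "(F has_real_derivative F') (at q)" "0 < F'"
  obtains c \<phi> where "wave_orbit b F c \<phi>"
proof -
  let ?b = "\<lambda>t. - b (1 - t)" and ?F = "\<lambda>t. F (1 - t)"
  obtain \<Phi> M where \<Phi>: "\<And>c. half_sol (\<lambda>s. b s + c) (\<lambda>s. - F s) q (\<Phi> c)"
    and \<Phi>c: "continuous_on UNIV (\<lambda>c. \<Phi> c q)" and \<Phi>m: "mono (\<lambda>c. \<Phi> c q)"
    and \<Phi>n: "\<And>c. 0 \<le> \<Phi> c q" and \<Phi>M: "\<And>c. (c - M) * q \<le> \<Phi> c q"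
    and \<Phi>p: "\<And>c. 0 \<le> b q + c \<Longrightarrow> 0 < \<Phi> c q"
    and \<Phi>d: "\<And>c. 0 < \<Phi> c q \<Longrightarrow> (\<Phi> c has_real_derivative b q + c) (at q within {0..q})"
  proof (rule shooting_family[of q b "\<lambda>s. - F s" b' "- F'"])
    show "((\<lambda>s. - F s) has_real_derivative - F') (at q within {0..q})"
      by (auto intro!: derivative_eq_intros DERIV_subset[OF Fd(1)])
  qed (use q F0 Fneg Fd(2) in \<open>auto intro!: continuous_intros continuous_on_subset[OF cb] continuous_on_subset[OF cF] DERIV_subset[OF bd]\<close>)
  have d1: "((\<lambda>t::real. 1 - t) has_real_derivative -1) (at t within S)" for t S
    by (auto intro!: derivative_eq_intros)
  obtain \<Psi> N where \<Psi>: "\<And>c. half_sol (\<lambda>t. ?b t + c) ?F (1 - q) (\<Psi> c)"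
    and \<Psi>c: "continuous_on UNIV (\<lambda>c. \<Psi> c (1 - q))" and \<Psi>m: "mono (\<lambda>c. \<Psi> c (1 - q))"
    and \<Psi>n: "\<And>c. 0 \<le> \<Psi> c (1 - q)" and \<Psi>M: "\<And>c. (c - N) * (1 - q) \<le> \<Psi> c (1 - q)"
    and \<Psi>p: "\<And>c. 0 \<le> ?b (1 - q) + c \<Longrightarrow> 0 < \<Psi> c (1 - q)"
    and \<Psi>d: "\<And>c. 0 < \<Psi> c (1 - q) \<Longrightarrow> (\<Psi> c has_real_derivative ?b (1 - q) + c) (at (1 - q) within {0..1 - q})"
  proof (rule shooting_family[of "1 - q" ?b ?F b' "- F'"])
    show "(?F has_real_derivative - F') (at (1 - q) within {0..1 - q})"
      using DERIV_chain2[of F F' "\<lambda>t. 1 - t" "1 - q" "-1" "{0..1 - q}"] d1 Fd(1) by simp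
    show "(?b has_real_derivative b') (at (1 - q) within {0..1 - q})"
      using DERIV_minus[OF DERIV_chain2[of b b' "\<lambda>t. 1 - t" "1 - q" "-1" "{0..1 - q}"]] d1 bd by simp
    show "continuous_on {0..1 - q} ?b" "continuous_on {0..1 - q} ?F"
      using q by (auto intro!: continuous_intros continuous_on_compose2[OF cb] continuous_on_compose2[OF cF])
  qed (use q F0 Fpos Fd(2) in auto)
  define G where "G c = \<Phi> (- c) q - \<Psi> c (1 - q)" for c
  have Gc: "continuous_on UNIV G"
    unfolding G_def by (intro continuous_intros \<Psi>c continuous_on_compose2[OF \<Phi>c]) auto
  \<comment> \<open>At speeds \<open>k\<close> and \<open>- k\<close> the linear lower bound of one
    orbit exceeds the value of the other at parameter \<open>0\<close>, which by monotonicity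
    dominates its value at parameter \<open>- k\<close>.\<close>
  define k where "k = max (\<bar>M\<bar> + \<Psi> 0 (1 - q) / q) (\<bar>N\<bar> + \<Phi> 0 q / (1 - q))"
  have k: "\<Psi> 0 (1 - q) \<le> (k - M) * q" "\<Phi> 0 q \<le> (k - N) * (1 - q)" "0 \<le> k"
  proof -
    have "\<Psi> 0 (1 - q) / q \<le> k - M" "\<Phi> 0 q / (1 - q) \<le> k - N" by (auto simp: k_def)
    then show "\<Psi> 0 (1 - q) \<le> (k - M) * q" "\<Phi> 0 q \<le> (k - N) * (1 - q)"
      using q by (auto simp: divide_le_eq)
    have "0 \<le> \<Psi> 0 (1 - q) / q" using \<Psi>n q by simp
    then show "0 \<le> k" by (simp add: k_def)
  qed
  have "G k \<le> 0"
    using monoD[OF \<Phi>m, of "-k" 0] k \<Psi>M[of k] by (simp add: G_def)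
  moreover have "0 \<le> G (- k)"
    using monoD[OF \<Psi>m, of "-k" 0] k \<Phi>M[of k] by (simp add: G_def)
  ultimately obtain c where c: "G c = 0"
    using IVT2'[of G k 0 "- k"] k(3) continuous_on_subset[OF Gc] by auto
  then have eq: "\<Phi> (- c) q = \<Psi> c (1 - q)" by (simp add: G_def)
  \<comment> \<open>The two drifts at \<open>q\<close> are opposite numbers, so one is nonnegative
    and the corresponding end value is positive; the other equals it.\<close>
  have pos: "0 < \<Phi> (- c) q"
    using \<Phi>p[of "- c"] \<Psi>p[of c] eq by (cases "0 \<le> b q - c") auto
  note l = half_solD[OF \<Phi>[of "- c"]] and r = half_solD[OF \<Psi>[of c]]
  define \<phi> where "\<phi> s = (if s \<le> q then \<Phi> (- c) s else \<Psi> c (1 - s))" for s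
  have \<phi>r: "\<phi> s = \<Psi> c (1 - s)" if "q \<le> s" for s using that eq by (cases "s = q") (auto simp: \<phi>_def)
  have U: "{0..1} = {0..q} \<union> {q..1}" using q by auto
  have rc: "continuous_on {q..1} (\<lambda>s. \<Psi> c (1 - s))"
    by (rule continuous_on_compose2[OF r(1)]) (auto intro!: continuous_intros)
  have "wave_orbit b F c \<phi>" unfolding wave_orbit_def
  proof (intro conjI ballI)
    have "continuous_on {0..q} \<phi>"
      by (rule continuous_on_eq[OF l(1)]) (simp add: \<phi>_def)
    moreover have "continuous_on {q..1} \<phi>"
      by (rule continuous_on_eq[OF rc]) (simp add: \<phi>r)
    ultimately show "continuous_on {0..1} \<phi>"
      unfolding U by (intro continuous_on_closed_Un) auto
    show "\<phi> 0 = 0" "\<phi> 1 = 0" using q l(2) r(2) by (auto simp: \<phi>_def)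
    fix s :: real assume s: "s \<in> {0<..<1}"
    show "0 < \<phi> s" using s l(3)[of s] r(3)[of "1 - s"] pos by (cases s q rule: linorder_cases) (auto simp: \<phi>_def)
    consider "s < q" | "s = q" | "q < s" by linarith
    then show "(\<phi> has_real_derivative b s - c - F s / \<phi> s) (at s)"
    proof cases
      case 1
      have "(\<Phi> (- c) has_real_derivative b s + - c + - F s / \<Phi> (- c) s) (at s)" using l(4) s 1 by simp
      then show ?thesis
        using 1 s q by (auto simp: \<phi>_def intro: has_field_derivative_transform_within_open[where S = "{..<q}"])
    next
      case 3
      have "((\<lambda>s. \<Psi> c (1 - s)) has_real_derivative (?b (1 - s) + c + ?F (1 - s) / \<Psi> c (1 - s)) * - 1) (at s)"
        by (rule DERIV_chain2[OF r(4) d1]) (use s 3 in auto)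
      then show ?thesis
        using 3 s q by (auto simp: \<phi>_def intro: has_field_derivative_transform_within_open[where S = "{q<..}"])
    next
      case 2
      \<comment> \<open>Since \<open>F q = 0\<close>, both one-sided derivatives at \<open>q\<close>
        are \<open>b q - c\<close>; the reflection contributes the factor \<open>-1\<close> on the
        right.\<close>
      have "(\<phi> has_real_derivative b q - c) (at q within {0..q})"
        by (rule has_field_derivative_transform_within[where d = 1, OF \<Phi>d[OF pos, simplified]])
           (use q in \<open>auto simp: \<phi>_def\<close>)
      moreover have "((\<lambda>t. 1 - t) ` {q..1}) = {0..1 - q}"
        by (auto simp: image_iff intro!: bexI[of _ "1 - _"])
      then have "((\<lambda>s. \<Psi> c (1 - s)) has_real_derivative (?b (1 - q) + c) * -1) (at q within {q..1})"
        using DERIV_image_chain[of "\<Psi> c" "?b (1 - q) + c" "\<lambda>s. 1 - s" q "{q..1}" "-1"] \<Psi>d[of c] pos eq d1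
        by (simp add: o_def)
      then have "(\<phi> has_real_derivative (?b (1 - q) + c) * -1) (at q within {q..1})"
        by (rule has_field_derivative_transform_within[where d = 1]) (use q \<phi>r in auto)
      ultimately have "(\<phi> has_real_derivative b q - c) (at q within {0..q} \<union> {q..1})"
        by (intro has_real_derivative_within_Un) auto
      then show ?thesis
        unfolding U[symmetric] using 2 q F0 by (simp add: at_within_Icc_at)
    qed
  qed
  then show thesis by (rule that)
qed

text \<open>For \<open>c < d\<close>, the orbit of speed \<open>c\<close> is strictly above the
  other at \<open>q\<close> when followed from \<open>0\<close>, and at most as high when followed
  from \<open>1\<close>. Once the speeds agree, uniqueness applies on each side of
  \<open>q\<close>.\<close>

lemma wave_orbit_unique:
  fixes b F :: "real \<Rightarrow> real"
  assumes q: "q \<in> {0<..<1}" and cF: "continuous_on {0..1} F"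
    and Fneg: "\<And>s. s \<in> {0<..<q} \<Longrightarrow> F s < 0" and Fpos: "\<And>s. s \<in> {q<..<1} \<Longrightarrow> 0 < F s"
    and \<phi>: "wave_orbit b F c \<phi>" and \<psi>: "wave_orbit b F d \<psi>"
  shows "c = d" and "\<And>s. s \<in> {0..1} \<Longrightarrow> \<phi> s = \<psi> s"
proof -
  have L: "half_sol (\<lambda>s. b s + - c) (\<lambda>s. - F s) q \<phi>" if "wave_orbit b F c \<phi>" for c \<phi>
    using half_sol_mono_on[OF wave_orbit_left[OF that]] q by simp
  have R: "half_sol (\<lambda>t. - b (1 - t) + c) (\<lambda>t. F (1 - t)) (1 - q) (\<lambda>t. \<phi> (1 - t))" 
    if "wave_orbit b F c \<phi>" for c \<phi>
    using half_sol_mono_on[OF wave_orbit_right[OF that]] q by simp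
  have cF': "continuous_on {0..q} (\<lambda>s. - F s)" "continuous_on {0..1 - q} (\<lambda>t. F (1 - t))"
    using q by (auto intro!: continuous_intros continuous_on_compose2[OF cF])
  have hl: "0 \<le> - F s" if "s \<in> {0<..<q}" for s using Fneg[OF that] by simp
  have hr: "0 \<le> F (1 - s)" if "s \<in> {0<..<1 - q}" for s using Fpos[of "1 - s"] that by simp
  have no: "\<not> c < d" if \<phi>: "wave_orbit b F c \<phi>" and \<psi>: "wave_orbit b F d \<psi>" for c d \<phi> \<psi>
  proof
    assume "c < d"
    have "\<psi> q < \<phi> q"
    proof (rule half_sol_less_at_end[OF L[OF \<psi>], of "d - c"])
      show "half_sol (\<lambda>s. b s + - d + (d - c)) (\<lambda>s. - F s) q \<phi>" using L[OF \<phi>] by simp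
    qed (use q \<open>c < d\<close> hl cF' wave_orbitD(4)[OF \<psi>] in auto)
    moreover have "\<phi> (1 - (1 - q)) \<le> \<psi> (1 - (1 - q)) + 0 * (1 - q)"
      by (rule half_sol_le[OF R[OF \<phi>] R[OF \<psi>] _ hr]) (use q \<open>c < d\<close> in auto)
    ultimately show False by simp
  qed
  show cd: "c = d" using no[OF \<phi> \<psi>] no[OF \<psi> \<phi>] by simp
  fix s :: real assume s: "s \<in> {0..1}"
  show "\<phi> s = \<psi> s"
  proof (cases "s \<le> q")
    case True
    then show ?thesis using half_sol_unique[OF L[OF \<phi>] L[OF \<psi>, folded cd] hl] s by simp
  next
    case False
    then show ?thesis
      using half_sol_unique[OF R[OF \<phi>] R[OF \<psi>, folded cd] hr, of "1 - s"] s by simp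
  qed
qed

section \<open>Unbounded increasing functions and their inverses\<close>

text \<open>\<open>T\<close> plays the role of the position at which a level is attained. Its
  infinite limits make it onto the real line, so the inverse is a profile defined
  everywhere.\<close>

lemma inverse_of_increasing:
  fixes T T' :: "real \<Rightarrow> real"
  assumes ab: "a < b"
    and T: "\<And>s. a < s \<Longrightarrow> s < b \<Longrightarrow> (T has_real_derivative T' s) (at s)"
    and T': "\<And>s. a < s \<Longrightarrow> s < b \<Longrightarrow> 0 < T' s"
    and lim: "filterlim T at_bot (at_right a)" "filterlim T at_top (at_left b)"
  obtains V where "strict_mono V" and "\<And>\<xi>. a < V \<xi>" and "\<And>\<xi>. V \<xi> < b"
    and "\<And>\<xi>. (V has_real_derivative inverse (T' (V \<xi>))) (at \<xi>)"
    and "(V \<longlongrightarrow> a) at_bot" and "(V \<longlongrightarrow> b) at_top"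
proof -
  have cont: "isCont T s" if "a < s" "s < b" for s using T[OF that] by (rule DERIV_isCont)
  have mono: "T s < T t" if "a < s" "s < t" "t < b" for s t
  proof (rule DERIV_pos_imp_increasing[OF that(2)])
    show "\<exists>y. (T has_real_derivative y) (at x) \<and> 0 < y" if "s \<le> x" "x \<le> t" for x
      using T[of x] T'[of x] that \<open>a < s\<close> \<open>t < b\<close> by auto
  qed
  have surj: "\<exists>s. a < s \<and> s < b \<and> T s = \<xi>" for \<xi>
  proof -
    define m where "m = (a + b) / 2"
    have m: "a < m" "m < b" using ab by (auto simp: m_def)
    have "\<forall>\<^sub>F s in at_right a. T s \<le> \<xi>" "\<forall>\<^sub>F s in at_left b. \<xi> \<le> T s"
      using lim by (auto simp: filterlim_at_bot filterlim_at_top)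
    moreover have "\<forall>\<^sub>F s in at_right a. s \<in> {a<..<m}" "\<forall>\<^sub>F s in at_left b. s \<in> {m<..<b}"
      using eventually_at_right_real[OF m(1)] eventually_at_left_real[OF m(2)] by auto
    ultimately have "\<forall>\<^sub>F s in at_right a. T s \<le> \<xi> \<and> s \<in> {a<..<m}" "\<forall>\<^sub>F s in at_left b. \<xi> \<le> T s \<and> s \<in> {m<..<b}"
      by (auto simp: eventually_conj_iff)
    from this[THEN eventually_happens'[rotated]] obtain u v
      where "T u \<le> \<xi>" "u \<in> {a<..<m}" "\<xi> \<le> T v" "v \<in> {m<..<b}" by (auto simp: trivial_limit_at_left_real)
    then obtain s where "u \<le> s" "s \<le> v" "T s = \<xi>"
      using IVT[of T u \<xi> v] cont m by auto
    then show ?thesis using \<open>u \<in> {a<..<m}\<close> \<open>v \<in> {m<..<b}\<close> by (intro exI[of _ s]) auto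
  qed
  then obtain V where V: "\<And>\<xi>. a < V \<xi>" "\<And>\<xi>. V \<xi> < b" "\<And>\<xi>. T (V \<xi>) = \<xi>" by metis
  have VT: "V (T s) = s" if "a < s" "s < b" for s
    using mono[of s "V (T s)"] mono[of "V (T s)" s] V[of "T s"] that by (cases s "V (T s)" rule: linorder_cases) auto
  have sm: "strict_mono V"
  proof (rule strict_monoI)
    fix x y :: real assume "x < y"
    then show "V x < V y"
      using mono[of "V y" "V x"] V[of x] V[of y] by (cases "V x" "V y" rule: linorder_cases) auto
  qed
  have Vc: "isCont V \<xi>" for \<xi>
    using isCont_inverse_function2[of "(a + V \<xi>) / 2" "V \<xi>" "(V \<xi> + b) / 2" V T] VT cont V[of \<xi>] by force
  have Vd: "(V has_real_derivative inverse (T' (V \<xi>))) (at \<xi>)" for \<xi>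
    by (rule DERIV_inverse_function[where f = T and a = "\<xi> - 1" and b = "\<xi> + 1"])
       (use T T'[of "V \<xi>"] V Vc in auto)
  have "(V \<longlongrightarrow> a) at_bot"
  proof (rule order_tendstoI)
    show "\<forall>\<^sub>F x in at_bot. y < V x" if "y < a" for y
      using V(1) that by (auto intro!: always_eventually less_trans[of y a])
    fix y assume y: "a < y"
    define e where "e = min y ((a + b) / 2)"
    have e: "a < e" "e < b" "e \<le> y" using y ab by (auto simp: e_def min_def field_simps)
    have "V x < y" if "x < T e" for x using strict_monoD[OF sm that] VT[OF e(1,2)] e by simp
    then show "\<forall>\<^sub>F x in at_bot. V x < y" unfolding eventually_at_bot_dense by blast
  qed
  moreover have "(V \<longlongrightarrow> b) at_top"
  proof (rule order_tendstoI)
    show "\<forall>\<^sub>F x in at_top. V x < y" if "b < y" for y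
      using V(2) that by (auto intro!: always_eventually less_trans[of _ b y])
    fix y assume y: "y < b"
    define e where "e = max y ((a + b) / 2)"
    have e: "a < e" "e < b" "y \<le> e" using y ab by (auto simp: e_def max_def field_simps)
    have "y < V x" if "T e < x" for x using strict_monoD[OF sm that] VT[OF e(1,2)] e by simp
    then show "\<forall>\<^sub>F x in at_top. y < V x" unfolding eventually_at_top_dense by blast
  qed
  ultimately show thesis using sm V Vd by (intro that) auto
qed

text \<open>\<open>T - \<kappa> ln\<close> is nondecreasing, so \<open>T\<close> lies below
  \<open>\<kappa> ln s\<close> plus a constant near \<open>0\<close>. This shows that an end state
  is reached only at infinity.\<close>

lemma filterlim_at_bot_of_log_deriv:
  fixes T T' :: "real \<Rightarrow> real"
  assumes d: "0 < d" and \<kappa>: "0 < \<kappa>"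
    and T: "\<And>s. 0 < s \<Longrightarrow> s < d \<Longrightarrow> (T has_real_derivative T' s) (at s)"
    and T': "\<And>s. 0 < s \<Longrightarrow> s < d \<Longrightarrow> \<kappa> / s \<le> T' s"
  shows "filterlim T at_bot (at_right 0)"
proof -
  define e where "e = d / 2"
  have e: "0 < e" "e < d" using d by (auto simp: e_def)
  have le: "T s \<le> T e - \<kappa> * ln e + \<kappa> * ln s" if s: "0 < s" "s < e" for s
  proof -
    have "T s - \<kappa> * ln s \<le> T e - \<kappa> * ln e"
    proof (rule DERIV_nonneg_imp_nondecreasing[of s e])
      fix x assume x: "s \<le> x" "x \<le> e"
      have "((\<lambda>s. T s - \<kappa> * ln s) has_real_derivative T' x - \<kappa> / x) (at x)"
        using x s e by (auto intro!: derivative_eq_intros T)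
      then show "\<exists>y. ((\<lambda>s. T s - \<kappa> * ln s) has_real_derivative y) (at x) \<and> 0 \<le> y"
        using T'[of x] x s e by force
    qed (use s in simp)
    then show ?thesis by simp
  qed
  have ln: "filterlim (\<lambda>s. \<kappa> * ln s) at_bot (at_right (0::real))"
    using filterlim_tendsto_pos_mult_at_bot[OF tendsto_const \<kappa> ln_at_0] .
  show ?thesis unfolding filterlim_at_bot
  proof
    fix Z
    have "\<forall>\<^sub>F s in at_right 0. \<kappa> * ln s \<le> Z - (T e - \<kappa> * ln e)"
      using ln by (simp add: filterlim_at_bot)
    with eventually_at_right_real[OF e(1)] show "\<forall>\<^sub>F s in at_right 0. T s \<le> Z"
      by eventually_elim (use le in force)
  qed
qed

lemma filterlim_one_minus_left:
  "filterlim (\<lambda>s::real. 1 - s) (at_right 0) (at_left 1)"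
  unfolding filterlim_at
  by (auto intro!: tendsto_eq_intros simp: eventually_at_left_field intro: exI[of _ 0])

lemma filterlim_one_minus_right:
  "filterlim (\<lambda>s::real. 1 - s) (at_left 1) (at_right 0)"
  unfolding filterlim_at
  by (auto intro!: tendsto_eq_intros simp: eventually_at_right_field intro: exI[of _ 1])

text \<open>L'Hospital's rule with denominator \<open>x\<close>. It turns limits of logarithmic
  derivatives of the profile into exponential rates.\<close>

lemma tendsto_over_arg_of_deriv:
  fixes u u' :: "real \<Rightarrow> real"
  assumes u: "\<And>x. (u has_real_derivative u' x) (at x)" and lim: "(u' \<longlongrightarrow> r) at_top"
  shows "((\<lambda>x. u x / x) \<longlongrightarrow> r) at_top"
  by (rule lhospital_at_top_at_top[where f' = u' and g' = "\<lambda>_. 1"])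
     (auto intro!: u derivative_eq_intros lim always_eventually filterlim_ident)

text \<open>Suppose \<open>\<phi>\<close> exceeds some \<open>\<epsilon>\<close> arbitrarily close
  to \<open>0\<close>. The lower bound on its slope then keeps it above
  \<open>\<epsilon> / 2\<close> on a whole interval \<open>(0,e]\<close>, where \<open>T'\<close> is
  bounded above, so \<open>T\<close> could not tend to minus infinity.\<close>

lemma tendsto_zero_of_unbounded_inverse:
  fixes \<phi> \<phi>' T T' :: "real \<Rightarrow> real"
  assumes d: "0 < d" and C: "0 < C"
    and \<phi>: "\<And>s. 0 < s \<Longrightarrow> s < d \<Longrightarrow> 0 < \<phi> s"
    and \<phi>': "\<And>s. 0 < s \<Longrightarrow> s < d \<Longrightarrow> (\<phi> has_real_derivative \<phi>' s) (at s)"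
      "\<And>s. 0 < s \<Longrightarrow> s < d \<Longrightarrow> - M \<le> \<phi>' s"
    and T: "\<And>s. 0 < s \<Longrightarrow> s < d \<Longrightarrow> (T has_real_derivative T' s) (at s)"
      "\<And>s. 0 < s \<Longrightarrow> s < d \<Longrightarrow> T' s \<le> C / \<phi> s"
    and unb: "filterlim T at_bot (at_right 0)"
  shows "(\<phi> \<longlongrightarrow> 0) (at_right 0)"
proof (rule order_tendstoI)
  show "\<forall>\<^sub>F s in at_right 0. y < \<phi> s" if "y < 0" for y
    using eventually_at_right_real[OF d] \<phi> that by (auto elim!: eventually_mono intro: less_trans)
  fix \<epsilon> :: real assume \<epsilon>: "0 < \<epsilon>"
  show "\<forall>\<^sub>F s in at_right 0. \<phi> s < \<epsilon>"
  proof (rule ccontr)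
    assume nev: "\<not> (\<forall>\<^sub>F s in at_right 0. \<phi> s < \<epsilon>)"
    \<comment> \<open>Over a length \<open>e\<close>, \<open>\<phi>\<close> can drop by at most
      \<open>\<bar>M\<bar> * e \<le> \<epsilon> / 2\<close>.\<close>
    define e where "e = min (d / 2) (\<epsilon> / (2 * (\<bar>M\<bar> + 1)))"
    have e: "0 < e" "e < d" using d \<epsilon> by (auto simp: e_def)
    have "e \<le> \<epsilon> / (2 * (\<bar>M\<bar> + 1))" by (simp add: e_def)
    then have "e * (2 * (\<bar>M\<bar> + 1)) \<le> \<epsilon>" by (subst (asm) pos_le_divide_eq) auto
    then have eM: "2 * (\<bar>M\<bar> * e) \<le> \<epsilon>" using e by (simp add: algebra_simps)
    have ge: "\<epsilon> / 2 \<le> \<phi> s" if s: "0 < s" "s \<le> e" for s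
    proof -
      obtain r where r: "0 < r" "r < s" "\<epsilon> \<le> \<phi> r"
        using nev s unfolding eventually_at_right_field by (metis not_less)
      have "\<phi> r + M * r \<le> \<phi> s + M * s"
      proof (rule DERIV_nonneg_imp_nondecreasing[of r s])
        fix x assume x: "r \<le> x" "x \<le> s"
        have "((\<lambda>s. \<phi> s + M * s) has_real_derivative \<phi>' x + M) (at x)"
          using x r s e by (auto intro!: derivative_eq_intros \<phi>')
        then show "\<exists>y. ((\<lambda>s. \<phi> s + M * s) has_real_derivative y) (at x) \<and> 0 \<le> y"
          using \<phi>'(2)[of x] x r s e by force
      qed (use r in simp)
      moreover have "M * (s - r) \<le> \<bar>M\<bar> * e"
        using r s by (intro mult_mono) auto
      ultimately show ?thesis using r eM by (simp add: algebra_simps)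
    qed
    have Tge: "T e - 2 * C / \<epsilon> * (e - s) \<le> T s" if s: "0 < s" "s \<le> e" for s
    proof -
      have "2 * C / \<epsilon> * s - T s \<le> 2 * C / \<epsilon> * e - T e"
      proof (rule DERIV_nonneg_imp_nondecreasing[of s e])
        fix x assume x: "s \<le> x" "x \<le> e"
        have "((\<lambda>s. 2 * C / \<epsilon> * s - T s) has_real_derivative 2 * C / \<epsilon> - T' x) (at x)"
          using x s e \<epsilon> by (auto intro!: derivative_eq_intros T)
        moreover have "C / \<phi> x \<le> C / (\<epsilon> / 2)"
          using ge[of x] x s \<epsilon> C by (intro divide_left_mono) auto
        then have "0 \<le> 2 * C / \<epsilon> - T' x" using T(2)[of x] x s e by (simp add: mult.commute)
        ultimately show "\<exists>y. ((\<lambda>s. 2 * C / \<epsilon> * s - T s) has_real_derivative y) (at x) \<and> 0 \<le> y" by blast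
      qed (use s in simp)
      then show ?thesis by (simp only: right_diff_distrib)
    qed
    define x where "x = T e - 2 * C / \<epsilon> * e - 1"
    have "\<forall>\<^sub>F s in at_right 0. T s \<le> x \<and> s \<in> {0<..<e}"
      using unb eventually_at_right_real[OF e(1)] by (auto simp: filterlim_at_bot eventually_conj_iff)
    from eventually_happens'[OF _ this] obtain s where s: "T s \<le> x" "0 < s" "s < e" by auto
    have "2 * C / \<epsilon> * (e - s) \<le> 2 * C / \<epsilon> * e" using s C \<epsilon> by (intro mult_left_mono) auto
    then show False using Tge[of s] s by (simp add: x_def)
  qed
qed

section \<open>Roots of the characteristic equation\<close>

lemma quadratic_pos_root:
  fixes a k :: real
  assumes "0 < k"
  obtains m where "0 < m" and "m\<^sup>2 = a * m + k"
proof
  let ?m = "(a + sqrt (a\<^sup>2 + 4 * k)) / 2"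
  have "sqrt (a\<^sup>2) < sqrt (a\<^sup>2 + 4 * k)" using assms by (intro real_sqrt_less_mono) simp
  then show "0 < ?m" by simp
  have "(sqrt (a\<^sup>2 + 4 * k))\<^sup>2 = a\<^sup>2 + 4 * k" using assms by simp
  then show "?m\<^sup>2 = a * ?m + k" by (simp add: power2_eq_square field_simps)
qed

text \<open>The product of two distinct roots would be \<open>f' e\<close> divided by
  \<open>\<sigma>2 e / 2\<close>, hence negative, so two roots of equal sign coincide.\<close>

lemma char_poly_root_unique:
  assumes "0 < \<sigma>2 e" and "f' e < 0" and "0 < \<rho> * \<tau>"
    and "char_poly_at \<sigma>2 b f' c e \<rho> = 0" and "char_poly_at \<sigma>2 b f' c e \<tau> = 0"
  shows "\<rho> = \<tau>"
proof -
  have "(\<rho> - \<tau>) * (1 / 2 * \<sigma>2 e * (\<rho> * \<tau>) - f' e)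
      = \<tau> * char_poly_at \<sigma>2 b f' c e \<rho> - \<rho> * char_poly_at \<sigma>2 b f' c e \<tau>"
    by (simp add: char_poly_at_def power2_eq_square field_simps)
  moreover have "0 < 1 / 2 * \<sigma>2 e * (\<rho> * \<tau>) - f' e"
    using assms(2) mult_pos_pos[OF assms(1,3)] by linarith
  ultimately show ?thesis using assms(4,5) by auto
qed

section \<open>From the orbit to the front\<close>

locale bistable_wave =
  fixes \<sigma>2 \<sigma>' b b' f f' :: "real \<Rightarrow> real" and q :: real
  assumes \<sigma>2: "C1_with_deriv \<sigma>2 \<sigma>' {0..1}" and b: "C1_with_deriv b b' {0..1}"
    and f: "C1_with_deriv f f' {0..1}"
    and \<sigma>2_pos: "\<And>s. s \<in> {0..1} \<Longrightarrow> 0 < \<sigma>2 s" and bi: "bistable f q"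
    and f'0: "f' 0 < 0" and f'q: "0 < f' q" and f'1: "f' 1 < 0"
begin

definition F :: "real \<Rightarrow> real" where "F s = \<sigma>2 s * f s / 2"

lemma q: "q \<in> {0<..<1}" using bi by (simp add: bistable_def)

lemma f_zero: "f 0 = 0" "f q = 0" "f 1 = 0" using bi by (auto simp: bistable_def)

lemma f_neg: "0 < s \<Longrightarrow> s < q \<Longrightarrow> f s < 0" using bi by (simp add: bistable_def)

lemma f_pos: "q < s \<Longrightarrow> s < 1 \<Longrightarrow> 0 < f s" using bi by (simp add: bistable_def)

lemma cont: "continuous_on {0..1} \<sigma>2" "continuous_on {0..1} b" "continuous_on {0..1} f"
    "continuous_on {0..1} \<sigma>'"
  using \<sigma>2 b f by (auto simp: C1_with_deriv_def intro: DERIV_continuous_on)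

lemma contF: "continuous_on {0..1} F"
  unfolding F_def by (intro continuous_intros cont) auto

lemma deriv_within: "s \<in> {0..1} \<Longrightarrow> (\<sigma>2 has_real_derivative \<sigma>' s) (at s within {0..1})"
    "s \<in> {0..1} \<Longrightarrow> (b has_real_derivative b' s) (at s within {0..1})"
    "s \<in> {0..1} \<Longrightarrow> (f has_real_derivative f' s) (at s within {0..1})"
  using \<sigma>2 b f by (auto simp: C1_with_deriv_def)

lemma deriv_at: "0 < s \<Longrightarrow> s < 1 \<Longrightarrow> (\<sigma>2 has_real_derivative \<sigma>' s) (at s)"
    "0 < s \<Longrightarrow> s < 1 \<Longrightarrow> (b has_real_derivative b' s) (at s)"
    "0 < s \<Longrightarrow> s < 1 \<Longrightarrow> (f has_real_derivative f' s) (at s)"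
  using deriv_within[of s] by (auto simp: at_within_Icc_at)

lemma F_deriv_within:
  "s \<in> {0..1} \<Longrightarrow> (F has_real_derivative (\<sigma>' s * f s + \<sigma>2 s * f' s) / 2) (at s within {0..1})"
  unfolding F_def by (auto intro!: derivative_eq_intros deriv_within)

lemma F_zero: "F 0 = 0" "F q = 0" "F 1 = 0" by (simp_all add: F_def f_zero)

lemma F_neg: "s \<in> {0<..<q} \<Longrightarrow> F s < 0"
  using q \<sigma>2_pos[of s] f_neg[of s] by (simp add: F_def mult_pos_neg)

lemma F_pos: "s \<in> {q<..<1} \<Longrightarrow> 0 < F s"
  using q \<sigma>2_pos[of s] f_pos[of s] by (simp add: F_def)

lemma \<sigma>2_bounds: obtains l u where "0 < l" and "\<And>s. s \<in> {0..1} \<Longrightarrow> l \<le> \<sigma>2 s \<and> \<sigma>2 s \<le> u"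
proof -
  obtain x where x: "x \<in> {0..1}" "\<And>y. y \<in> {0..1} \<Longrightarrow> \<sigma>2 x \<le> \<sigma>2 y"
    using continuous_attains_inf[OF compact_Icc _ cont(1)] by fastforce
  obtain y where y: "\<And>s. s \<in> {0..1} \<Longrightarrow> \<sigma>2 s \<le> \<sigma>2 y"
    using continuous_attains_sup[OF compact_Icc _ cont(1)] by fastforce
  show thesis using that[of "\<sigma>2 x" "\<sigma>2 y"] x y \<sigma>2_pos by blast
qed

text \<open>The constant term is \<open>- F'(0)\<close>, as \<open>f 0 = 0\<close>. Substituting
  \<open>m = \<sigma>2 0 * r / 2\<close> turns the quadratic for the slope into the characteristic
  equation for \<open>r\<close>.\<close>

lemma orbit_slope_left:
  assumes \<phi>: "wave_orbit b F c \<phi>"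
  obtains m where "0 < m" and "m\<^sup>2 = (b 0 - c) * m + - (\<sigma>2 0 * f' 0) / 2"
    and "((\<lambda>s. \<phi> s / s) \<longlongrightarrow> m) (at_right 0)"
proof -
  define k where "k = - (\<sigma>2 0 * f' 0) / 2"
  have k: "0 < k" using f'0 \<sigma>2_pos[of 0] by (simp add: k_def mult_pos_neg)
  obtain m where m: "0 < m" "m\<^sup>2 = (b 0 - c) * m + k" using quadratic_pos_root[OF k] by blast
  have W: "at (0::real) within {0..1} = at_right 0" by (simp add: at_within_Icc_at_right)
  have "(b \<longlongrightarrow> b 0) (at_right 0)" using cont(2) W by (auto simp: continuous_on dest!: bspec[of _ _ 0])
  then have A: "((\<lambda>s. b s + - c) \<longlongrightarrow> b 0 - c) (at_right 0)" by (auto intro!: tendsto_eq_intros)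
  have "((\<lambda>s. (F s - F 0) / (s - 0)) \<longlongrightarrow> - k) (at_right 0)"
    using F_deriv_within[of 0] unfolding has_field_derivative_iff W by (simp add: k_def f_zero)
  from tendsto_minus[OF this] have h: "((\<lambda>s. - F s / s) \<longlongrightarrow> k) (at_right 0)" by (simp add: F_zero)
  have "((\<lambda>s. \<phi> s / s) \<longlongrightarrow> m) (at_right 0)"
    by (rule half_sol_slope[OF wave_orbit_left[OF \<phi>] _ A h k m]) simp
  with m show thesis by (intro that) (auto simp: k_def)
qed

lemma orbit_slope_right:
  assumes \<phi>: "wave_orbit b F c \<phi>"
  obtains m where "0 < m" and "m\<^sup>2 = (c - b 1) * m + - (\<sigma>2 1 * f' 1) / 2"
    and "((\<lambda>t. \<phi> (1 - t) / t) \<longlongrightarrow> m) (at_right 0)"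
proof -
  define k where "k = - (\<sigma>2 1 * f' 1) / 2"
  have k: "0 < k" using f'1 \<sigma>2_pos[of 1] by (simp add: k_def mult_pos_neg)
  obtain m where m: "0 < m" "m\<^sup>2 = (c - b 1) * m + k" using quadratic_pos_root[OF k] by blast
  have W: "at (1::real) within {0..1} = at_left 1" by (simp add: at_within_Icc_at_left)
  note lim = filterlim_one_minus_right
  have "(b \<longlongrightarrow> b 1) (at_left 1)" using cont(2) W by (auto simp: continuous_on dest!: bspec[of _ _ 1])
  from filterlim_compose[OF this lim]
  have A: "((\<lambda>t. - b (1 - t) + c) \<longlongrightarrow> c - b 1) (at_right 0)" by (auto intro!: tendsto_eq_intros)
  have "((\<lambda>s. (F s - F 1) / (s - 1)) \<longlongrightarrow> - k) (at_left 1)"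
    using F_deriv_within[of 1] unfolding has_field_derivative_iff W by (simp add: k_def f_zero)
  from tendsto_minus[OF filterlim_compose[OF this lim]]
  have h: "((\<lambda>t. F (1 - t) / t) \<longlongrightarrow> k) (at_right 0)" by (simp add: F_zero)
  have "((\<lambda>t. \<phi> (1 - t) / t) \<longlongrightarrow> m) (at_right 0)"
    by (rule half_sol_slope[OF wave_orbit_right[OF \<phi>] _ A h k m]) simp
  with m show thesis by (intro that) (auto simp: k_def)
qed

text \<open>Separation of variables in \<open>V' = g(V)\<close>: an antiderivative \<open>T\<close>
  of \<open>1 / g\<close> is inverted. The finite slopes of the orbit at \<open>0\<close> and
  \<open>1\<close> make \<open>T\<close> diverge logarithmically there, so \<open>V\<close> exists
  on the whole line.\<close>

lemma wavefront_of_orbit: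
  assumes \<phi>: "wave_orbit b F c \<phi>"
  obtains V where "wavefront \<sigma>2 b f c V"
proof -
  note p = wave_orbitD[OF \<phi>]
  define g where "g s = 2 * \<phi> s / \<sigma>2 s" for s
  define \<phi>' where "\<phi>' s = b s - c - F s / \<phi> s" for s
  define g' where "g' s = 2 * (\<phi>' s * \<sigma>2 s - \<phi> s * \<sigma>' s) / (\<sigma>2 s)\<^sup>2" for s
  have \<sigma>p: "0 < \<sigma>2 s" if "0 < s" "s < 1" for s using \<sigma>2_pos[of s] that by simp
  have gp: "0 < g s" if "0 < s" "s < 1" for s using p(4)[OF that] \<sigma>p[OF that] by (simp add: g_def)
  have gd: "(g has_real_derivative g' s) (at s)" if "0 < s" "s < 1" for s
    using p(5)[OF that] deriv_at(1)[OF that] \<sigma>p[OF that] unfolding g_def g'_def \<phi>'_def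
    by (auto intro!: derivative_eq_intros simp: power2_eq_square field_simps)
  obtain l u where l: "0 < l" "\<And>s. s \<in> {0..1} \<Longrightarrow> l \<le> \<sigma>2 s \<and> \<sigma>2 s \<le> u" using \<sigma>2_bounds by blast
  have "\<exists>T. \<forall>x::real. 0 < ereal x \<longrightarrow> ereal x < 1 \<longrightarrow> (T has_vector_derivative 1 / g x) (at x)"
  proof (rule einterval_antiderivative)
    fix x :: real assume "0 < ereal x" "ereal x < 1"
    then have x: "0 < x" "x < 1" by auto
    show "isCont (\<lambda>x. 1 / g x) x" using DERIV_isCont[OF gd[OF x]] gp[OF x] by (intro continuous_intros) auto
  qed simp
  then obtain T where T: "\<And>x. 0 < x \<Longrightarrow> x < 1 \<Longrightarrow> (T has_real_derivative 1 / g x) (at x)"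
    by (auto simp: has_real_derivative_iff_has_vector_derivative)
  \<comment> \<open>The map \<open>\<tau>\<close> covers both ends: it is the identity at
    \<open>0\<close> and the reflection at \<open>1\<close>. The constant comes from
    \<open>\<phi> (\<tau> t) \<le> 2 * m * t\<close> and \<open>l \<le> \<sigma>2\<close>.\<close>
  have log_bound: "\<exists>d \<kappa>. 0 < d \<and> d \<le> 1 \<and> 0 < \<kappa> \<and> (\<forall>t. 0 < t \<longrightarrow> t < d \<longrightarrow> \<kappa> / t \<le> 1 / g (\<tau> t))"
    if \<tau>: "\<And>t. 0 < t \<Longrightarrow> t < 1 \<Longrightarrow> 0 < \<tau> t \<and> \<tau> t < 1" and lim: "((\<lambda>t. \<phi> (\<tau> t) / t) \<longlongrightarrow> m) (at_right 0)"
      and m: "0 < m" for \<tau> m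
  proof -
    have "\<forall>\<^sub>F t in at_right 0. \<phi> (\<tau> t) / t < 2 * m" by (rule order_tendstoD[OF lim]) (use m in simp)
    then obtain d where d: "0 < d" "\<And>t. 0 < t \<Longrightarrow> t < d \<Longrightarrow> \<phi> (\<tau> t) / t < 2 * m"
      unfolding eventually_at_right_field by blast
    show ?thesis
    proof (intro exI conjI allI impI)
      show "0 < min d 1" "min d 1 \<le> 1" "0 < l / (4 * m)" using d l m by auto
      fix t assume t: "0 < t" "t < min d 1"
      then have s: "0 < \<tau> t" "\<tau> t < 1" using \<tau>[of t] by auto
      have "\<phi> (\<tau> t) \<le> 2 * m * t" using d(2)[of t] t by (simp add: field_simps)
      then have "\<phi> (\<tau> t) * l \<le> (2 * m * t) * \<sigma>2 (\<tau> t)"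
        using l(1) l(2)[of "\<tau> t"] s p(4)[OF s] t m by (intro mult_mono) auto
      then show "l / (4 * m) / t \<le> 1 / g (\<tau> t)"
        using t m s \<sigma>p[OF s] p(4)[OF s] by (simp add: g_def field_simps)
    qed
  qed
  obtain m where m: "0 < m" "((\<lambda>s. \<phi> s / s) \<longlongrightarrow> m) (at_right 0)" using orbit_slope_left[OF \<phi>] by blast
  obtain d \<kappa> where d: "0 < d" "d \<le> 1" "0 < \<kappa>" "\<And>t. 0 < t \<Longrightarrow> t < d \<Longrightarrow> \<kappa> / t \<le> 1 / g t"
    using log_bound[of "\<lambda>t. t" m] m by blast
  have T0: "filterlim T at_bot (at_right 0)"
    by (rule filterlim_at_bot_of_log_deriv[OF d(1,3) T d(4)]) (use d in auto)
  obtain n where n: "0 < n" "((\<lambda>t. \<phi> (1 - t) / t) \<longlongrightarrow> n) (at_right 0)" using orbit_slope_right[OF \<phi>] by blast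
  obtain e \<nu> where e: "0 < e" "e \<le> 1" "0 < \<nu>" "\<And>t. 0 < t \<Longrightarrow> t < e \<Longrightarrow> \<nu> / t \<le> 1 / g (1 - t)"
    using log_bound[of "\<lambda>t. 1 - t" n] n by auto
  have "filterlim (\<lambda>t. - T (1 - t)) at_bot (at_right 0)"
  proof (rule filterlim_at_bot_of_log_deriv[OF e(1,3) _ e(4)])
    fix t assume t: "0 < t" "t < e"
    have "((\<lambda>t. - T (1 - t)) has_real_derivative - (1 / g (1 - t) * - 1)) (at t)"
      by (rule DERIV_minus[OF DERIV_chain2[OF T]]) (use t e in \<open>auto intro!: derivative_eq_intros\<close>)
    then show "((\<lambda>t. - T (1 - t)) has_real_derivative 1 / g (1 - t)) (at t)" by simp
  qed
  from filterlim_compose[OF this filterlim_one_minus_left]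
  have T1: "filterlim T at_top (at_left 1)" by (simp add: filterlim_uminus_at_top)
  obtain V where V: "strict_mono V" "\<And>\<xi>. 0 < V \<xi>" "\<And>\<xi>. V \<xi> < 1"
      "\<And>\<xi>. (V has_real_derivative inverse (1 / g (V \<xi>))) (at \<xi>)" "(V \<longlongrightarrow> 0) at_bot" "(V \<longlongrightarrow> 1) at_top"
    by (rule inverse_of_increasing[of 0 1 T "\<lambda>s. 1 / g s"]) (use T gp T0 T1 in auto)
  have Vd: "(V has_real_derivative g (V \<xi>)) (at \<xi>)" for \<xi> using V(4)[of \<xi>] by simp
  have dV: "deriv V = (\<lambda>\<xi>. g (V \<xi>))" using DERIV_imp_deriv[OF Vd] by auto
  have Vdd: "(deriv V has_real_derivative g' (V \<xi>) * g (V \<xi>)) (at \<xi>)" for \<xi>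
    unfolding dV by (rule DERIV_chain2[OF gd Vd]) (use V in auto)
  have ddV: "deriv (deriv V) = (\<lambda>\<xi>. g' (V \<xi>) * g (V \<xi>))" using DERIV_imp_deriv[OF Vdd] by auto
  have sub: "{0<..<1} \<subseteq> {0..1::real}" by auto
  note c' = cont[THEN continuous_on_subset, OF sub] contF[THEN continuous_on_subset, OF sub] 
     p(1)[THEN continuous_on_subset, OF sub]
  have "continuous_on {0<..<1} (\<lambda>s. g' s * g s)" unfolding g'_def g_def \<phi>'_def
    using \<sigma>p p(4) by (intro continuous_intros c') (force simp: less_imp_neq[symmetric])+
  then have "continuous_on UNIV (\<lambda>\<xi>. g' (V \<xi>) * g (V \<xi>))"
    by (rule continuous_on_compose2) (use V DERIV_isCont[OF Vd] in \<open>auto intro: continuous_at_imp_continuous_on\<close>)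
  then have C2: "C2_real V" unfolding C2_real_def ddV
    using Vd Vdd by (auto simp: real_differentiable_def)
  have Pd: "((\<lambda>x. \<sigma>2 (V x) / 2 * deriv V x) has_real_derivative \<phi>' (V \<xi>) * g (V \<xi>)) (at \<xi>)" for \<xi>
  proof -
    have "(\<lambda>x. \<sigma>2 (V x) / 2 * deriv V x) = (\<lambda>x. \<phi> (V x))"
      using \<sigma>p[OF V(2) V(3)] by (auto simp: dV g_def less_imp_neq[symmetric])
    moreover have "((\<lambda>x. \<phi> (V x)) has_real_derivative \<phi>' (V \<xi>) * g (V \<xi>)) (at \<xi>)"
      unfolding \<phi>'_def by (rule DERIV_chain2[OF p(5) Vd]) (use V in auto)
    ultimately show ?thesis by simp
  qed
  have "traveling_wave_eq \<sigma>2 b f c V" unfolding traveling_wave_eq_def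
  proof (intro allI conjI)
    fix \<xi>
    show "(\<lambda>x. \<sigma>2 (V x) / 2 * deriv V x) differentiable at \<xi>" using Pd by (auto simp: real_differentiable_def)
    have "F (V \<xi>) / \<phi> (V \<xi>) * g (V \<xi>) = f (V \<xi>)"
      using \<sigma>p[OF V(2,3), of \<xi> ] p(4)[OF V(2,3), of \<xi>] by (simp add: F_def g_def)
    then show "deriv (\<lambda>x. \<sigma>2 (V x) / 2 * deriv V x) \<xi> + (c - b (V \<xi>)) * deriv V \<xi> + f (V \<xi>) = 0"
      unfolding DERIV_imp_deriv[OF Pd] unfolding dV \<phi>'_def by (simp add: algebra_simps)
  qed
  then show thesis using V C2 by (intro that) (simp add: wavefront_def)
qed

end

section \<open>From a front to the orbit\<close>

locale front = bistable_wave +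
  fixes c :: real and V :: "real \<Rightarrow> real"
  assumes wf: "wavefront \<sigma>2 b f c V"
begin

lemma V_mono: "x < y \<Longrightarrow> V x < V y"
  using wf by (simp add: wavefront_def strict_mono_def)

lemma V_lim: "(V \<longlongrightarrow> 0) at_bot" "(V \<longlongrightarrow> 1) at_top"
  using wf by (auto simp: wavefront_def)

lemma V_range: "0 < V x" "V x < 1"
proof -
  have "0 \<le> V (x - 1)"
  proof (rule tendsto_upperbound[OF V_lim(1)])
    show "\<forall>\<^sub>F y in at_bot. V y \<le> V (x - 1)"
      using V_mono[of _ "x - 1"] by (auto simp: eventually_at_bot_dense intro!: exI[of _ "x - 1"] less_imp_le)
  qed simp
  then show "0 < V x" using V_mono[of "x - 1" x] by simp
  have "V (x + 1) \<le> 1"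
  proof (rule tendsto_lowerbound[OF V_lim(2)])
    show "\<forall>\<^sub>F y in at_top. V (x + 1) \<le> V y"
      using V_mono[of "x + 1"] by (auto simp: eventually_at_top_dense intro!: exI[of _ "x + 1"] less_imp_le)
  qed simp
  then show "V x < 1" using V_mono[of x "x + 1"] by simp
qed

lemma V_range': "V x \<in> {0..1}" using V_range[of x] by simp

lemma V_deriv: "(V has_real_derivative deriv V x) (at x)"
  using wf by (simp add: wavefront_def C2_real_def DERIV_deriv_iff_real_differentiable)

lemma V_deriv_nonneg: "0 \<le> deriv V x"
  using wf by (intro mono_on_imp_deriv_nonneg[OF _ V_deriv, of UNIV])
    (auto simp: wavefront_def strict_mono_mono)

text \<open>The flux as a function of position; \<open>flux\<close> is the same quantity as a
  function of the level.\<close>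

definition P :: "real \<Rightarrow> real" where "P x = \<sigma>2 (V x) / 2 * deriv V x"

lemma P_deriv: "(P has_real_derivative (b (V x) - c) * deriv V x - f (V x)) (at x)"
proof -
  have "(P has_real_derivative deriv P x) (at x)"
    and "deriv P x + (c - b (V x)) * deriv V x + f (V x) = 0"
    using wf unfolding wavefront_def traveling_wave_eq_def P_def
    by (auto simp: DERIV_deriv_iff_real_differentiable)
  moreover from this(2) have "deriv P x = (b (V x) - c) * deriv V x - f (V x)" by (simp add: algebra_simps)
  ultimately show ?thesis by simp
qed

text \<open>
  At a critical point the flux is minimal, so \<open>f (V x) = 0\<close> and \<open>V x = q\<close>. To the right of it
  \<open>f (V) > 0\<close>, which bounds the flux, and hence \<open>V'\<close>, by a multiple of \<open>V - q\<close>; by Gronwall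
  \<open>V\<close> would be constant.
\<close>

lemma V_deriv_pos: "0 < deriv V x"
proof (rule ccontr)
  assume "\<not> 0 < deriv V x"
  then have z: "deriv V x = 0" using V_deriv_nonneg[of x] by simp
  have P0: "P x = 0" by (simp add: P_def z)
  have Pn: "0 \<le> P y" for y using \<sigma>2_pos[OF V_range'[of y]] V_deriv_nonneg[of y] by (simp add: P_def)
  have "(b (V x) - c) * deriv V x - f (V x) = 0"
    by (rule DERIV_local_min[OF P_deriv, of 1]) (auto simp: P0 Pn)
  then have "f (V x) = 0" using z by simp
  then have Vx: "V x = q"
    using f_neg[of "V x"] f_pos[of "V x"] V_range[of x] by (cases "V x" q rule: linorder_cases) auto
  have "bounded (b ` {0..1})"
    by (intro compact_imp_bounded compact_continuous_image cont compact_Icc)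
  then obtain B where B: "\<And>s. s \<in> {0..1} \<Longrightarrow> \<bar>b s\<bar> \<le> B" unfolding bounded_real by blast
  define K where "K = B + \<bar>c\<bar>"
  have "0 \<le> K" using B[of 0] by (simp add: K_def)
  have K: "b (V y) - c \<le> K" for y using B[OF V_range'[of y]] by (simp add: K_def)
  obtain l u where l: "0 < l" "\<And>s. s \<in> {0..1} \<Longrightarrow> l \<le> \<sigma>2 s \<and> \<sigma>2 s \<le> u" using \<sigma>2_bounds by blast
  define C where "C = 2 * K / l"
  have Vy: "q \<le> V y" if "x \<le> y" for y using V_mono[of x y] that Vx by (cases "x = y") auto
  have dV: "deriv V y \<le> C * (V y - q)" if y: "x \<le> y" for y
  proof -
    \<comment> \<open>By the wave equation the derivative is
      \<open>(K - (b (V t) - c)) * deriv V t + f (V t)\<close>, and both summands are nonnegative to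
      the right of \<open>x\<close>.\<close>
    have "K * V x - P x \<le> K * V y - P y"
    proof (rule DERIV_nonneg_imp_nondecreasing[OF y])
      fix t assume t: "x \<le> t" "t \<le> y"
      have "0 \<le> f (V t)" using Vy[OF t(1)] f_pos[of "V t"] f_zero V_range[of t] by (cases "V t = q") auto
      moreover have "(b (V t) - c) * deriv V t \<le> K * deriv V t"
        by (intro mult_right_mono K V_deriv_nonneg)
      moreover have "((\<lambda>t. K * V t - P t) has_real_derivative K * deriv V t - ((b (V t) - c) * deriv V t - f (V t))) (at t)"
        by (auto intro!: derivative_eq_intros P_deriv V_deriv)
      ultimately show "\<exists>d. ((\<lambda>t. K * V t - P t) has_real_derivative d) (at t) \<and> 0 \<le> d" by force
    qed
    then have "P y \<le> K * (V y - q)" by (simp add: P0 Vx algebra_simps)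
    moreover have "l / 2 * deriv V y \<le> P y"
      unfolding P_def using l(2)[OF V_range'[of y]] V_deriv_nonneg[of y] by (intro mult_right_mono) auto
    ultimately have "l / 2 * deriv V y \<le> K * (V y - q)" by simp
    then show ?thesis using l(1) by (simp add: C_def field_simps)
  qed
  have "- (exp (- C * x) * (V x - q)) \<le> - (exp (- C * (x + 1)) * (V (x + 1) - q))"
  proof (rule DERIV_nonneg_imp_nondecreasing[of x "x + 1"])
    fix t assume t: "x \<le> t" "t \<le> x + 1"
    have "((\<lambda>t. - (exp (- C * t) * (V t - q))) has_real_derivative exp (- C * t) * (C * (V t - q) - deriv V t)) (at t)"
      by (auto intro!: derivative_eq_intros V_deriv simp: algebra_simps)
    then show "\<exists>d. ((\<lambda>t. - (exp (- C * t) * (V t - q))) has_real_derivative d) (at t) \<and> 0 \<le> d"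
      using dV[OF t(1)] by (intro exI conjI) auto
  qed simp
  then have "exp (- C * (x + 1)) * (V (x + 1) - q) \<le> 0" by (simp add: Vx)
  then have "V (x + 1) \<le> q" by (simp add: mult_le_0_iff)
  then show False using V_mono[of x "x + 1"] Vx by simp
qed

section \<open>The inverse profile and the flux as a function of the level\<close>

lemma V_cont: "isCont V x" by (rule DERIV_isCont[OF V_deriv])

lemma inj_V: "inj V"
  using wf by (auto simp: wavefront_def strict_mono_imp_inj_on)

lemma inv_V [simp]: "inv V (V x) = x"
  using inj_V by simp

lemma V_surj: assumes "0 < s" "s < 1" shows "\<exists>x. V x = s"
proof -
  have "\<exists>u. V u < s" "\<exists>v. s < V v"
    using order_tendstoD(2)[OF V_lim(1) assms(1)] order_tendstoD(1)[OF V_lim(2) assms(2)]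
    by (auto dest: eventually_happens)
  then obtain u v where uv: "V u < s" "s < V v" by blast
  then have "u < v" using V_mono[of v u] by (cases u v rule: linorder_cases) auto
  then show ?thesis using IVT[of V u s v] uv V_cont by auto
qed

lemma V_inv: "0 < s \<Longrightarrow> s < 1 \<Longrightarrow> V (inv V s) = s"
  using V_surj f_inv_into_f[of s V UNIV] by (metis rangeI)

lemma inv_V_cont: "0 < s \<Longrightarrow> s < 1 \<Longrightarrow> isCont (inv V) s"
  using isCont_inverse_function2[of "inv V s - 1" "inv V s" "inv V s + 1" "inv V" V] V_cont V_inv[of s] by auto

lemma inv_V_deriv:
  assumes "0 < s" "s < 1"
  shows "(inv V has_real_derivative 1 / level_param V s) (at s)"
proof -
  have "(inv V has_real_derivative inverse (deriv V (inv V s))) (at s)"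
    by (rule DERIV_inverse_function[where f = V and a = 0 and b = 1])
       (use assms V_deriv V_deriv_pos[of "inv V s"] V_inv inv_V_cont in auto)
  then show ?thesis by (simp add: level_param_def inverse_eq_divide)
qed

lemma level_pos: "0 < level_param V s" by (simp add: level_param_def V_deriv_pos)

lemma flux_pos: "0 < s \<Longrightarrow> s < 1 \<Longrightarrow> 0 < flux \<sigma>2 V s"
  using \<sigma>2_pos[of s] level_pos[of s] by (simp add: flux_def)

text \<open>On \<open>(0,1)\<close> the flux is \<open>P\<close> composed with \<open>inv V\<close>,
  and the chain rule divides the equation for \<open>P\<close> by \<open>V'\<close>.\<close>

lemma flux_deriv:
  assumes s: "0 < s" "s < 1"
  shows "(flux \<sigma>2 V has_real_derivative b s - c - f s / level_param V s) (at s)"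
proof -
  have "((\<lambda>t. P (inv V t)) has_real_derivative
      ((b (V (inv V s)) - c) * deriv V (inv V s) - f (V (inv V s))) * (1 / level_param V s)) (at s)"
    by (rule DERIV_chain2[OF P_deriv inv_V_deriv[OF s]])
  moreover have "((b (V (inv V s)) - c) * deriv V (inv V s) - f (V (inv V s))) * (1 / level_param V s)
      = b s - c - f s / level_param V s"
    using level_pos[of s] by (simp add: V_inv[OF s] level_param_def field_simps)
  ultimately have "((\<lambda>t. P (inv V t)) has_real_derivative b s - c - f s / level_param V s) (at s)" by simp
  then show ?thesis
    by (rule has_field_derivative_transform_within_open[where S = "{0<..<1}"])
       (use s in \<open>auto simp: P_def flux_def level_param_def V_inv\<close>)
qed

lemma inv_V_at_bot: "filterlim (inv V) at_bot (at_right 0)"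
  unfolding filterlim_at_bot
proof
  fix Z
  show "\<forall>\<^sub>F s in at_right 0. inv V s \<le> Z"
    using eventually_at_right_real[OF V_range(1)[of Z]]
  proof eventually_elim
    case (elim s)
    then show ?case using V_mono[of Z "inv V s"] V_inv[of s] V_range(2)[of Z] by (cases "Z < inv V s") auto
  qed
qed

lemma inv_V_at_top: "filterlim (inv V) at_top (at_left 1)"
  unfolding filterlim_at_top
proof
  fix Z
  show "\<forall>\<^sub>F s in at_left 1. Z \<le> inv V s"
    using eventually_at_left_real[OF V_range(2)[of Z]]
  proof eventually_elim
    case (elim s)
    then show ?case using V_mono[of "inv V s" Z] V_inv[of s] V_range(1)[of Z] by (cases "inv V s < Z") auto
  qed
qed

text \<open>The inverse profile is unbounded at each end while its derivative is at most a constant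
  over the flux. The sign of \<open>f\<close> on \<open>(0,q)\<close>, and after reflection on
  \<open>(q,1)\<close>, bounds the slope of the flux from below.\<close>

lemma flux_lim: "(flux \<sigma>2 V \<longlongrightarrow> 0) (at_right 0)" "(flux \<sigma>2 V \<longlongrightarrow> 0) (at_left 1)"
proof -
  have "bounded (b ` {0..1})"
    by (intro compact_imp_bounded compact_continuous_image cont compact_Icc)
  then obtain B where B: "\<And>s. s \<in> {0..1} \<Longrightarrow> \<bar>b s\<bar> \<le> B" unfolding bounded_real by blast
  define M where "M = B + \<bar>c\<bar>"
  have M: "\<bar>b s - c\<bar> \<le> M" if "s \<in> {0..1}" for s using B[OF that] by (simp add: M_def)
  obtain l u where l: "0 < l" "\<And>s. s \<in> {0..1} \<Longrightarrow> l \<le> \<sigma>2 s \<and> \<sigma>2 s \<le> u" using \<sigma>2_bounds by blast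
  have u: "0 < u" using l(1) l(2)[of 0] by simp
  have inv_le: "1 / level_param V s \<le> (u / 2) / flux \<sigma>2 V s" if "0 < s" "s < 1" for s
    using l(2)[of s] that level_pos[of s] \<sigma>2_pos[of s] by (simp add: flux_def field_simps)
  show "(flux \<sigma>2 V \<longlongrightarrow> 0) (at_right 0)"
  proof (rule tendsto_zero_of_unbounded_inverse[of q "u / 2" _ _ M "inv V"])
    show "(flux \<sigma>2 V has_real_derivative b s - c - f s / level_param V s) (at s)"
      "(inv V has_real_derivative 1 / level_param V s) (at s)" "0 < flux \<sigma>2 V s"
      "1 / level_param V s \<le> u / 2 / flux \<sigma>2 V s"
      if "0 < s" "s < q" for s
      using flux_deriv[of s] inv_V_deriv[of s] flux_pos[of s] inv_le[of s] that q by auto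
    show "- M \<le> b s - c - f s / level_param V s" if "0 < s" "s < q" for s
      using M[of s] that q divide_neg_pos[OF f_neg[OF that] level_pos[of s]] by auto
  qed (use q u inv_V_at_bot in auto)
  have "((\<lambda>t. flux \<sigma>2 V (1 - t)) \<longlongrightarrow> 0) (at_right 0)"
  proof (rule tendsto_zero_of_unbounded_inverse[of "1 - q" "u / 2" _ _ M "\<lambda>t. - inv V (1 - t)"])
    fix t :: real assume t: "0 < t" "t < 1 - q"
    have s: "0 < 1 - t" "1 - t < 1" using t q by auto
    have d1: "((\<lambda>t::real. 1 - t) has_real_derivative -1) (at t)" by (auto intro!: derivative_eq_intros)
    show "((\<lambda>t. flux \<sigma>2 V (1 - t)) has_real_derivative
        - (b (1 - t) - c) + f (1 - t) / level_param V (1 - t)) (at t)"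
      using DERIV_chain2[OF flux_deriv[OF s] d1] by (rule DERIV_cong) simp
    show "((\<lambda>t. - inv V (1 - t)) has_real_derivative 1 / level_param V (1 - t)) (at t)"
      using DERIV_minus[OF DERIV_chain2[OF inv_V_deriv[OF s] d1]] by simp
    show "1 / level_param V (1 - t) \<le> u / 2 / flux \<sigma>2 V (1 - t)" "0 < flux \<sigma>2 V (1 - t)"
      using inv_le[OF s] flux_pos[OF s] by auto
    have "0 < f (1 - t)" using f_pos[of "1 - t"] t by simp
    then have "0 < f (1 - t) / level_param V (1 - t)" using level_pos by simp
    then show "- M \<le> - (b (1 - t) - c) + f (1 - t) / level_param V (1 - t)" using M[of "1 - t"] s by auto
  next
    show "filterlim (\<lambda>t. - inv V (1 - t)) at_bot (at_right 0)"
      using filterlim_compose[OF inv_V_at_top, of "\<lambda>t. 1 - t" "at_right 0"]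
      unfolding filterlim_uminus_at_top by (simp add: filterlim_one_minus_right)
  qed (use q u in auto)
  from filterlim_compose[OF this filterlim_one_minus_left]
  show "(flux \<sigma>2 V \<longlongrightarrow> 0) (at_left 1)" by simp
qed

text \<open>The limits of the flux are prescribed at the end points because \<open>inv V\<close> is
  arbitrary outside \<open>(0,1)\<close>.\<close>

definition orbit :: "real \<Rightarrow> real" where
  "orbit s = (if s \<in> {0<..<1} then flux \<sigma>2 V s else 0)"

lemma wave_orbit: "wave_orbit b F c orbit"
  unfolding wave_orbit_def
proof (intro conjI ballI)
  have od: "(orbit has_real_derivative b s - c - f s / level_param V s) (at s)" if "0 < s" "s < 1" for s
    by (rule has_field_derivative_transform_within_open[OF flux_deriv[OF that], where S = "{0<..<1}"])
       (use that in \<open>auto simp: orbit_def\<close>)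
  show "continuous_on {0..1} orbit"
  proof (rule continuous_on_IccI)
    show "(orbit \<longlongrightarrow> orbit 0) (at_right 0)"
      using flux_lim(1)
    proof (rule Lim_transform_eventually[THEN tendsto_eq_rhs])
      show "\<forall>\<^sub>F s in at_right 0. flux \<sigma>2 V s = orbit s"
        using eventually_at_right_real[of 0 1] by (auto simp: orbit_def elim!: eventually_mono)
    qed (simp add: orbit_def)
    show "(orbit \<longlongrightarrow> orbit 1) (at_left 1)"
      using flux_lim(2)
    proof (rule Lim_transform_eventually[THEN tendsto_eq_rhs])
      show "\<forall>\<^sub>F s in at_left 1. flux \<sigma>2 V s = orbit s"
        using eventually_at_left_real[of 0 1] by (auto simp: orbit_def elim!: eventually_mono)
    qed (simp add: orbit_def)
    show "orbit \<midarrow>s\<rightarrow> orbit s" if "0 < s" "s < 1" for s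
      using DERIV_isCont[OF od[OF that]] by (simp add: isCont_def)
  qed simp
  fix s :: real assume s: "s \<in> {0<..<1}"
  then show "0 < orbit s" using flux_pos[of s] by (simp add: orbit_def)
  have "F s / orbit s = f s / level_param V s"
    using s \<sigma>2_pos[of s] level_pos[of s] by (simp add: F_def orbit_def flux_def)
  then show "(orbit has_real_derivative b s - c - F s / orbit s) (at s)"
    using od[of s] s by simp
qed (simp_all add: orbit_def)

section \<open>Exponential rates at the end states\<close>

lemma deriv_V_eq: "deriv V x = 2 * orbit (V x) / \<sigma>2 (V x)"
  using V_range[of x] \<sigma>2_pos[OF V_range'[of x]] by (simp add: orbit_def flux_def level_param_def)

text \<open>\<open>V' / V\<close> is \<open>2 * (orbit s / s) / \<sigma>2 s\<close> at
  \<open>s = V x\<close>, so its limit is determined by the slope of the orbit at \<open>0\<close>.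
  It is the derivative of \<open>ln V\<close>, and L'Hospital's rule gives the rate.\<close>

lemma left_rate:
  "\<exists>r. {\<rho>. \<rho> > 0 \<and> char_poly_at \<sigma>2 b f' c 0 \<rho> = 0} = {r} \<and>
     ((\<lambda>\<xi>. inverse \<xi> * ln \<bar>V \<xi> - 0\<bar>) \<longlongrightarrow> r) at_bot"
proof -
  obtain m where m: "0 < m" "m\<^sup>2 = (b 0 - c) * m + - (\<sigma>2 0 * f' 0) / 2"
    and lim: "((\<lambda>s. orbit s / s) \<longlongrightarrow> m) (at_right 0)" by (rule orbit_slope_left[OF wave_orbit])
  define r where "r = 2 * m / \<sigma>2 0"
  have \<sigma>0: "0 < \<sigma>2 0" using \<sigma>2_pos[of 0] by simp
  have r: "0 < r" using m \<sigma>0 by (simp add: r_def)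
  have "char_poly_at \<sigma>2 b f' c 0 r = 2 / \<sigma>2 0 * (m\<^sup>2 - ((b 0 - c) * m + - (\<sigma>2 0 * f' 0) / 2))"
    using \<sigma>0 by (simp add: char_poly_at_def r_def power2_eq_square field_simps)
  then have root: "char_poly_at \<sigma>2 b f' c 0 r = 0" using m by simp
  have roots: "{\<rho>. \<rho> > 0 \<and> char_poly_at \<sigma>2 b f' c 0 \<rho> = 0} = {r}"
  proof (intro equalityI subsetI)
    fix \<rho> assume "\<rho> \<in> {\<rho>. \<rho> > 0 \<and> char_poly_at \<sigma>2 b f' c 0 \<rho> = 0}"
    then have "0 < \<rho> * r" "char_poly_at \<sigma>2 b f' c 0 \<rho> = 0" using r by auto
    from char_poly_root_unique[OF \<sigma>0 f'0 this root] show "\<rho> \<in> {r}" by simp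
  qed (use r root in simp)
  have "(\<sigma>2 \<longlongrightarrow> \<sigma>2 0) (at_right 0)"
    using cont(1) by (auto simp: continuous_on at_within_Icc_at_right dest!: bspec[of _ _ 0])
  then have 1: "((\<lambda>s. 2 * (orbit s / s) / \<sigma>2 s) \<longlongrightarrow> r) (at_right 0)"
    unfolding r_def using \<sigma>0 by (intro tendsto_intros lim) auto
  have 2: "filterlim V (at_right 0) at_bot"
    unfolding filterlim_at using V_lim(1) V_range by (auto simp: less_imp_neq[symmetric])
  from filterlim_compose[OF 1 2] have "((\<lambda>x. 2 * (orbit (V x) / V x) / \<sigma>2 (V x)) \<longlongrightarrow> r) at_bot"
    .
  then have "((\<lambda>x. deriv V x / V x) \<longlongrightarrow> r) at_bot" by (simp add: deriv_V_eq mult.commute)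
  \<comment> \<open>Mirrored, because the L'Hospital lemma is stated at plus infinity.\<close>
  then have lim': "((\<lambda>x. deriv V (- x) / V (- x)) \<longlongrightarrow> r) at_top" by (simp add: filterlim_at_bot_mirror)
  have "((\<lambda>x. - ln (V (- x)) / x) \<longlongrightarrow> r) at_top"
  proof (rule tendsto_over_arg_of_deriv[OF _ lim'])
    fix x
    have "((\<lambda>x. V (- x)) has_real_derivative deriv V (- x) * -1) (at x)"
      by (rule DERIV_chain2[OF V_deriv]) (auto intro!: derivative_eq_intros)
    then show "((\<lambda>x. - ln (V (- x))) has_real_derivative deriv V (- x) / V (- x)) (at x)"
      using V_range(1)[of "- x"] by (auto intro!: derivative_eq_intros simp: field_simps)
  qed
  then have "((\<lambda>\<xi>. inverse \<xi> * ln \<bar>V \<xi> - 0\<bar>) \<longlongrightarrow> r) at_bot"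
    using V_range(1) by (simp add: filterlim_at_bot_mirror divide_inverse mult.commute abs_of_pos)
  with roots show ?thesis by blast
qed

text \<open>As at the other end, with \<open>ln (1 - V)\<close> in place of \<open>ln V\<close>. As
  \<open>1 - V\<close> decays, the rate is minus twice the slope over
  \<open>\<sigma>2 1\<close>.\<close>

lemma right_rate:
  "\<exists>r. {\<rho>. \<rho> < 0 \<and> char_poly_at \<sigma>2 b f' c 1 \<rho> = 0} = {r} \<and>
     ((\<lambda>\<xi>. inverse \<xi> * ln \<bar>V \<xi> - 1\<bar>) \<longlongrightarrow> r) at_top"
proof -
  obtain m where m: "0 < m" "m\<^sup>2 = (c - b 1) * m + - (\<sigma>2 1 * f' 1) / 2"
    and lim: "((\<lambda>t. orbit (1 - t) / t) \<longlongrightarrow> m) (at_right 0)" by (rule orbit_slope_right[OF wave_orbit])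
  define r where "r = - (2 * m / \<sigma>2 1)"
  have \<sigma>1: "0 < \<sigma>2 1" using \<sigma>2_pos[of 1] by simp
  have r: "r < 0" using m \<sigma>1 by (simp add: r_def)
  have "char_poly_at \<sigma>2 b f' c 1 r = 2 / \<sigma>2 1 * (m\<^sup>2 - ((c - b 1) * m + - (\<sigma>2 1 * f' 1) / 2))"
    using \<sigma>1 by (simp add: char_poly_at_def r_def power2_eq_square field_simps)
  then have root: "char_poly_at \<sigma>2 b f' c 1 r = 0" using m by simp
  have roots: "{\<rho>. \<rho> < 0 \<and> char_poly_at \<sigma>2 b f' c 1 \<rho> = 0} = {r}"
  proof (intro equalityI subsetI)
    fix \<rho> assume "\<rho> \<in> {\<rho>. \<rho> < 0 \<and> char_poly_at \<sigma>2 b f' c 1 \<rho> = 0}"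
    then have "0 < \<rho> * r" "char_poly_at \<sigma>2 b f' c 1 \<rho> = 0" using r by (auto simp: mult_neg_neg)
    from char_poly_root_unique[OF \<sigma>1 f'1 this root] show "\<rho> \<in> {r}" by simp
  qed (use r root in simp)
  have lim2: "((\<lambda>s. orbit s / (1 - s)) \<longlongrightarrow> m) (at_left 1)"
    using filterlim_compose[OF lim filterlim_one_minus_left] by simp
  have "(\<sigma>2 \<longlongrightarrow> \<sigma>2 1) (at_left 1)"
    using cont(1) by (auto simp: continuous_on at_within_Icc_at_left dest!: bspec[of _ _ 1])
  then have 1: "((\<lambda>s. - (2 * (orbit s / (1 - s)) / \<sigma>2 s)) \<longlongrightarrow> r) (at_left 1)"
    unfolding r_def using \<sigma>1 by (intro tendsto_intros lim2) auto
  have 2: "filterlim V (at_left 1) at_top"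
    unfolding filterlim_at using V_lim(2) V_range by (auto simp: less_imp_neq)
  from filterlim_compose[OF 1 2] have "((\<lambda>x. - (2 * (orbit (V x) / (1 - V x)) / \<sigma>2 (V x))) \<longlongrightarrow> r) at_top"
    .
  then have lim': "((\<lambda>x. - (deriv V x / (1 - V x))) \<longlongrightarrow> r) at_top" by (simp add: deriv_V_eq mult.commute)
  have "((\<lambda>x. ln (1 - V x) / x) \<longlongrightarrow> r) at_top"
  proof (rule tendsto_over_arg_of_deriv[OF _ lim'])
    show "((\<lambda>x. ln (1 - V x)) has_real_derivative - (deriv V x / (1 - V x))) (at x)" for x
      using V_range(2)[of x] by (auto intro!: derivative_eq_intros V_deriv simp: field_simps)
  qed
  then have "((\<lambda>\<xi>. inverse \<xi> * ln \<bar>V \<xi> - 1\<bar>) \<longlongrightarrow> r) at_top"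
    using V_range(2) by (simp add: divide_inverse mult.commute abs_if)
  with roots show ?thesis by blast
qed

end

text \<open>Both fronts yield the same orbit and hence the same level parameterization. Their
  inverse profiles therefore have equal derivatives on \<open>(0,1)\<close> and differ by a
  constant, which is the translation.\<close>

lemma (in bistable_wave) front_unique:
  assumes V: "wavefront \<sigma>2 b f c V" and W: "wavefront \<sigma>2 b f d W"
  shows "d = c \<and> (\<exists>h. \<forall>\<xi>. W \<xi> = V (\<xi> + h))"
proof -
  interpret V: front \<sigma>2 \<sigma>' b b' f f' q c V by unfold_locales (rule V)
  interpret W: front \<sigma>2 \<sigma>' b b' f f' q d W by unfold_locales (rule W)
  note unique = wave_orbit_unique[OF q contF F_neg F_pos V.wave_orbit W.wave_orbit]
  have level: "level_param V s = level_param W s" if "s \<in> {0<..<1}" for s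
    using unique(2)[of s] that \<sigma>2_pos[of s] by (simp add: V.orbit_def W.orbit_def flux_def)
  define h where "h = inv V q - inv W q"
  have "W \<xi> = V (\<xi> + h)" for \<xi>
  proof -
    have "inv V (W \<xi>) - inv W (W \<xi>) = inv V q - inv W q"
    proof (rule DERIV_isconst3[of 0 1 _ _ "\<lambda>s. inv V s - inv W s"])
      fix s :: real assume s: "s \<in> {0<..<1}"
      then have "((\<lambda>s. inv V s - inv W s) has_real_derivative 1 / level_param V s - 1 / level_param W s) (at s)"
        by (intro DERIV_diff V.inv_V_deriv W.inv_V_deriv) auto
      then show "((\<lambda>s. inv V s - inv W s) has_real_derivative 0) (at s)" by (simp add: level[OF s])
    qed (use q W.V_range in auto)
    then have "inv V (W \<xi>) = \<xi> + h" by (simp add: h_def)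
    then show ?thesis using V.V_inv[OF W.V_range] by metis
  qed
  then show ?thesis using unique(1) by blast
qed

lemma (in bistable_wave) front_exists: "\<exists>c V. wavefront \<sigma>2 b f c V"
proof -
  have q': "0 < q" "q < 1" using q by auto
  have "(F has_real_derivative \<sigma>2 q * f' q / 2) (at q)"
    using F_deriv_within[of q] q' by (simp add: at_within_Icc_at f_zero)
  moreover have "0 < \<sigma>2 q * f' q / 2" using \<sigma>2_pos[of q] q' f'q by simp
  ultimately obtain c \<phi> where "wave_orbit b F c \<phi>"
    using wave_orbit_exists[OF q cont(2) contF F_zero F_neg F_pos deriv_at(2)[OF q']] by blast
  from wavefront_of_orbit[OF this] show ?thesis by blast
qed

theorem theorem4p2:
  fixes \<sigma>2 b f f' :: "real \<Rightarrow> real" and q :: real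
  assumes "C1_on \<sigma>2 {0..1}" and "C1_on b {0..1}"
    and "0 < (INF s\<in>{0..1}. \<sigma>2 s)"
    and "C1_with_deriv f f' {0..1}"
    and "bistable f q"
    and "f' 0 < 0" and "f' q > 0" and "f' 1 < 0"
  shows
    "(\<exists>c V. wavefront \<sigma>2 b f c V \<and>
        (\<forall>c' W. wavefront \<sigma>2 b f c' W \<longrightarrow> c' = c \<and> (\<exists>h. \<forall>\<xi>. W \<xi> = V (\<xi> + h)))) \<and>
     (\<forall>c V. wavefront \<sigma>2 b f c V \<longrightarrow>
        (\<exists>r. {\<rho>. \<rho> > 0 \<and> char_poly_at \<sigma>2 b f' c 0 \<rho> = 0} = {r} \<and>
             ((\<lambda>\<xi>. inverse \<xi> * ln \<bar>V \<xi> - 0\<bar>) \<longlongrightarrow> r) at_bot) \<and>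
        (\<exists>r. {\<rho>. \<rho> < 0 \<and> char_poly_at \<sigma>2 b f' c 1 \<rho> = 0} = {r} \<and>
             ((\<lambda>\<xi>. inverse \<xi> * ln \<bar>V \<xi> - 1\<bar>) \<longlongrightarrow> r) at_top)) \<and>
     (\<forall>c V. wavefront \<sigma>2 b f c V \<longrightarrow>
        (\<forall>s\<in>{0<..<1}. level_param V s \<noteq> 0 \<and>
           (flux \<sigma>2 V has_real_derivative (b s - c - f s / level_param V s)) (at s)) \<and>
        (flux \<sigma>2 V \<longlongrightarrow> 0) (at_right 0) \<and> (flux \<sigma>2 V \<longlongrightarrow> 0) (at_left 1))"
proof -
  obtain \<sigma>' b' where \<sigma>': "C1_with_deriv \<sigma>2 \<sigma>' {0..1}" and b': "C1_with_deriv b b' {0..1}"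
    using assms(1,2) by (auto simp: C1_on_def)
  have "continuous_on {0..1} \<sigma>2"
    using \<sigma>' by (auto simp: C1_with_deriv_def intro: DERIV_continuous_on)
  \<comment> \<open>On the reals \<open>INF\<close> is a true lower bound only for sets bounded
    below.\<close>
  then have "bdd_below (\<sigma>2 ` {0..1})"
    by (intro bounded_imp_bdd_below compact_imp_bounded compact_continuous_image compact_Icc)
  then have pos: "0 < \<sigma>2 s" if "s \<in> {0..1}" for s
    using cINF_lower[of \<sigma>2 "{0..1}" s] that assms(3) by simp
  interpret bistable_wave \<sigma>2 \<sigma>' b b' f f' q
    by unfold_locales (use \<sigma>' b' assms pos in auto)
  have fr: "front \<sigma>2 \<sigma>' b b' f f' q c V" if "wavefront \<sigma>2 b f c V" for c V
    by unfold_locales (rule that)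
  obtain c V where V: "wavefront \<sigma>2 b f c V" using front_exists by blast
  show ?thesis
  proof (intro conjI allI impI ballI)
    show "\<exists>c V. wavefront \<sigma>2 b f c V \<and>
        (\<forall>c' W. wavefront \<sigma>2 b f c' W \<longrightarrow> c' = c \<and> (\<exists>h. \<forall>\<xi>. W \<xi> = V (\<xi> + h)))"
      using V front_unique[OF V] by blast
  next
    fix c V s assume "wavefront \<sigma>2 b f c V"
    then interpret front \<sigma>2 \<sigma>' b b' f f' q c V by (rule fr)
    show "level_param V s \<noteq> 0" using level_pos[of s] by simp
    show "(flux \<sigma>2 V has_real_derivative (b s - c - f s / level_param V s)) (at s)" if "s \<in> {0<..<1}"
      using flux_deriv that by simp
  qed (use front.left_rate[OF fr] front.right_rate[OF fr] front.flux_lim[OF fr] in blast)+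
qed

end
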